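(* Let $V$ be a complex vector space of finite dimension at least $2$ and let $f$ be an irreducible EKP-homaloidal polynomial function of degree three on $V$. Then $f$ is the relative polynomial invariant of an irreducible prehomogeneous symmetric space (with underlying vector space $V$).
   Context: Let $V$ be a complex vector space of finite dimension $\geq 2$ with dual $V^*$. For a function $f$ on $V$ and $x\in V$, $f'(x)\in V^*$ denotes the differential of $f$ at $x$. Multiplicative Legendre transform: if $f$ is a homogeneous function on $V$ such that the Hessian of $\ln f$ is generically invertible (i.e. $\det \mathrm{Hess}(\ln f)$ is not identically zero), its multiplicative Legendre transform $f_*$ is the homogeneous function on $V^*$ satisfying $f_*\left(\frac{f'(x)}{f(x)}\right)=\frac{1}{f(x)}$ for all $x$ in an open subset of $V$ (such a function always exists). EKP-homaloidal: a homogeneous polynomial function $f$ on $V$ with $\det\mathrm{Hess}(\ln f)\neq 0$ is called EKP-homaloidal if its multiplicative Legendre transform $f_*$ is again a polynomial. In this case $f_*$ is homogeneous and $\deg f_*=\deg f$. Prehomogeneous vector space: a pair $(G,V)$ where $G$ is a linear algebraic group over $\mathbb{C}$ acting on $V$ by a rational linear representation with a Zariski dense open orbit. It is irreducible if $V$ is an irreducible representation of $G$. A relative (polynomial) invariant of $(G,V)$ is a nonzero polynomial $f$ on $V$ such that there is a character $\chi$ of $G$ with $f(g\cdot x)=\chi(g)f(x)$ for all $g\in G$, $x\in V$. Prehomogeneous symmetric space: a prehomogeneous vector space $(G,V)$ for which there exists an involution of the group $G$ such that the stabilizer of a point in the dense orbit is contained in the set of fixed points of the involution and contains the connected component of the identity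 of this fixed-point set. *)

theory Defs
  imports
    "HOL-Analysis.Analysis"
    "HOL-Algebra.Ring_Divisibility"
    "Jordan_Normal_Form.Determinant"
begin

no_notation Matrix.vec_index (infixl \<open>$\<close> 100)

inductive_set generated_algebra :: "('a \<Rightarrow> complex) set \<Rightarrow> ('a \<Rightarrow> complex) set"
  for S :: "('a \<Rightarrow> complex) set"
where
  gen: "s \<in> S \<Longrightarrow> s \<in> generated_algebra S"
| const: "(\<lambda>_. c) \<in> generated_algebra S"
| add: "p \<in> generated_algebra S \<Longrightarrow> q \<in> generated_algebra S \<Longrightarrow>
    (\<lambda>x. p x + q x) \<in> generated_algebra S"
| mult: "p \<in> generated_algebra S \<Longrightarrow> q \<in> generated_algebra S \<Longrightarrow>
    (\<lambda>x. p x * q x) \<in> generated_algebra S"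

text \<open>
  The space \<open>V\<close> is \<open>complex ^ 'n\<close>. Its dual is \<open>complex ^ 'n\<close> as well, a vector \<open>y\<close> standing for the
  linear form with coefficients \<open>y $ i\<close> on the standard basis.
\<close>

definition polynomial_functions :: "(complex ^ 'n \<Rightarrow> complex) set" where
  "polynomial_functions = generated_algebra (range (\<lambda>i x. x $ i))"

definition polynomial_function_ring :: "(complex ^ 'n \<Rightarrow> complex) ring" where
  "polynomial_function_ring =
    \<lparr>carrier = polynomial_functions, mult = (\<lambda>p q x. p x * q x), one = (\<lambda>_. 1),
     zero = (\<lambda>_. 0), add = (\<lambda>p q x. p x + q x)\<rparr>"

definition zariski :: "'a set \<Rightarrow> ('a \<Rightarrow> complex) set \<Rightarrow> 'a topology" where
  "zariski X R = topology_generated_by {{x \<in> X. p x \<noteq> 0} | p. p \<in> R}"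

lemma topspace_zariski: "topspace (zariski X (generated_algebra S)) = X"
proof -
  have "X \<in> {{x \<in> X. p x \<noteq> 0} | p. p \<in> generated_algebra S}"
    by (intro CollectI exI[of _ "\<lambda>_. 1"] conjI generated_algebra.const) simp
  then have "X \<subseteq> \<Union>{{x \<in> X. p x \<noteq> 0} | p. p \<in> generated_algebra S}"
    by (rule Union_upper)
  moreover have "\<Union>{{x \<in> X. p x \<noteq> 0} | p. p \<in> generated_algebra S} \<subseteq> X"
    by (intro Union_least) auto
  ultimately show ?thesis
    unfolding zariski_def topology_generated_by_topspace by simp
qed

lemma closedin_zariski_iff:
  "closedin (zariski X (generated_algebra S)) Z \<longleftrightarrow>
    (\<exists>P \<subseteq> generated_algebra S. Z = {x \<in> X. \<forall>p\<in>P. p x = 0})"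
proof -
  let ?R = "generated_algebra S"
  let ?T = "zariski X ?R"
  have basic: "openin ?T {x \<in> X. p x \<noteq> 0}" if "p \<in> ?R" for p
    unfolding zariski_def using that by (intro topology_generated_by_Basis CollectI exI[of _ p]) simp
  have opens: "\<exists>P \<subseteq> ?R. U = {x \<in> X. \<exists>p\<in>P. p x \<noteq> 0}"
    if "generate_topology_on {{x \<in> X. p x \<noteq> 0} | p. p \<in> ?R} U" for U
    using that
  proof induction
    case Empty
    show ?case by (intro exI[of _ "{}"]) simp
  next
    case (Int U V)
    then obtain P Q where PQ: "P \<subseteq> ?R" "Q \<subseteq> ?R"
      "U = {x \<in> X. \<exists>p\<in>P. p x \<noteq> 0}" "V = {x \<in> X. \<exists>p\<in>Q. p x \<noteq> 0}" by (elim exE conjE)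
    let ?M = "(\<lambda>(p, q) x. p x * q x) ` (P \<times> Q)"
    show ?case
    proof (intro exI[of _ ?M] conjI)
      show "?M \<subseteq> ?R"
        using PQ(1,2) by (auto intro!: generated_algebra.mult)
      show "U \<inter> V = {x \<in> X. \<exists>r\<in>?M. r x \<noteq> 0}"
        unfolding PQ(3,4) by auto
    qed
  next
    case (UN K)
    then have "\<forall>U\<in>K. \<exists>P. P \<subseteq> ?R \<and> U = {x \<in> X. \<exists>p\<in>P. p x \<noteq> 0}" by simp
    from bchoice[OF this] obtain F
      where F: "\<forall>U\<in>K. F U \<subseteq> ?R \<and> U = {x \<in> X. \<exists>p\<in>F U. p x \<noteq> 0}" ..
    show ?case
    proof (intro exI[of _ "\<Union>(F ` K)"] conjI)
      show "\<Union>(F ` K) \<subseteq> ?R" by (rule UN_least) (use F in simp)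
      have "\<Union>K = (\<Union>U\<in>K. U)" by simp
      also have "\<dots> = (\<Union>U\<in>K. {x \<in> X. \<exists>p\<in>F U. p x \<noteq> 0})"
        by (rule SUP_cong[OF refl]) (drule bspec[OF F], elim conjunct2)
      also have "\<dots> = {x \<in> X. \<exists>p\<in>\<Union>(F ` K). p x \<noteq> 0}" by auto
      finally show "\<Union>K = {x \<in> X. \<exists>p\<in>\<Union>(F ` K). p x \<noteq> 0}" .
    qed
  next
    case (Basis U)
    then obtain p where "p \<in> ?R" "U = {x \<in> X. p x \<noteq> 0}" by (elim CollectE exE conjE)
    then show ?case by (intro exI[of _ "{p}"]) simp
  qed
  show ?thesis
  proof
    assume cl: "closedin ?T Z"
    then have "openin ?T (X - Z)" and "Z \<subseteq> X"
      by (auto simp: closedin_def topspace_zariski)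
    then have "generate_topology_on {{x \<in> X. p x \<noteq> 0} | p. p \<in> ?R} (X - Z)"
      unfolding zariski_def openin_topology_generated_by_iff by simp
    from opens[OF this] obtain P where P: "P \<subseteq> ?R" "X - Z = {x \<in> X. \<exists>p\<in>P. p x \<noteq> 0}"
      by (elim exE conjE)
    have "Z = X - (X - Z)" using \<open>Z \<subseteq> X\<close> by auto
    also have "\<dots> = {x \<in> X. \<forall>p\<in>P. p x = 0}" unfolding P(2) by auto
    finally show "\<exists>P \<subseteq> ?R. Z = {x \<in> X. \<forall>p\<in>P. p x = 0}" using P(1) by (intro exI[of _ P] conjI)
  next
    assume "\<exists>P \<subseteq> ?R. Z = {x \<in> X. \<forall>p\<in>P. p x = 0}"
    then obtain P where P: "P \<subseteq> ?R" "Z = {x \<in> X. \<forall>p\<in>P. p x = 0}" by (elim exE conjE)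
    have "X - Z = (\<Union>p\<in>P. {x \<in> X. p x \<noteq> 0})" using P(2) by auto
    moreover have "openin ?T (\<Union>p\<in>P. {x \<in> X. p x \<noteq> 0})"
      by (rule openin_Union) (use basic P(1) in auto)
    ultimately show "closedin ?T Z" using P(2) by (auto simp: closedin_def topspace_zariski)
  qed
qed

definition partial :: "'n \<Rightarrow> (complex ^ 'n \<Rightarrow> complex) \<Rightarrow> complex ^ 'n \<Rightarrow> complex" where
  "partial i f x = deriv (\<lambda>t. f (x + axis i t)) 0"

definition differential :: "(complex ^ 'n \<Rightarrow> complex) \<Rightarrow> complex ^ 'n \<Rightarrow> complex ^ 'n" where
  "differential f x = (\<chi> i. partial i f x)"

definition hessian :: "(complex ^ 'n \<Rightarrow> complex) \<Rightarrow> complex ^ 'n \<Rightarrow> complex ^ 'n ^ 'n" where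
  "hessian f x = (\<chi> i j. partial i (partial j f) x)"

text \<open>
  Where \<open>f x \<noteq> 0\<close>, the function \<open>y \<mapsto> Ln (f y / f x)\<close> is near \<open>x\<close> a holomorphic branch of the
  logarithm of \<open>f\<close>, up to an additive constant. (The Hessian of \<open>y \<mapsto> Ln (f y)\<close> itself would be
  spoilt at points where \<open>f x\<close> lies on the branch cut.)
\<close>

definition hessian_log :: "(complex ^ 'n \<Rightarrow> complex) \<Rightarrow> complex ^ 'n \<Rightarrow> complex ^ 'n ^ 'n" where
  "hessian_log f x = hessian (\<lambda>y. Ln (f y / f x)) x"

lemma polynomial_function_field_differentiable:
  assumes "p \<in> polynomial_functions"
  shows "(\<lambda>t. p (x + axis i t)) field_differentiable at t0"
  using assms unfolding polynomial_functions_def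
proof (induction)
  case (gen s)
  then obtain j where "s = (\<lambda>x. x $ j)" by auto
  then show ?case by (cases "i = j") (auto simp: axis_def intro!: derivative_intros)
qed (auto intro!: derivative_intros)

lemma hessian_log_polynomial_function:
  assumes "p \<in> polynomial_functions" and "p x \<noteq> 0"
  shows "hessian_log p x $ i $ j = partial i (\<lambda>y. partial j p y / p y) x"
proof -
  have ax: "v + axis k 0 = v" for v :: "complex ^ 'n" and k
    by (simp add: axis_eq_0_iff)
  have *: "partial j (\<lambda>y. Ln (p y / p x)) y = partial j p y / p y" if "p y / p x \<notin> \<real>\<^sub>\<le>\<^sub>0" for y
  proof -
    have nz: "p y \<noteq> 0" using that by auto
    have "((\<lambda>t. p (y + axis j t)) has_field_derivative partial j p y) (at 0)"
      unfolding partial_def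
      using polynomial_function_field_differentiable[OF assms(1)] field_differentiable_derivI
      by blast
    then have "((\<lambda>t. Ln (p (y + axis j t) / p x)) has_field_derivative partial j p y / p y) (at 0)"
      using that nz assms(2) by (auto intro!: derivative_eq_intros simp: ax field_simps)
    then show ?thesis unfolding partial_def by (rule DERIV_imp_deriv)
  qed
  have ev: "\<forall>\<^sub>F t in nhds 0. p (x + axis i t) / p x \<in> - \<real>\<^sub>\<le>\<^sub>0"
  proof -
    have "isCont (\<lambda>t. p (x + axis i t) / p x) 0"
      using polynomial_function_field_differentiable[OF assms(1), of x i 0] assms(2)
      by (auto intro!: field_differentiable_imp_continuous_at field_differentiable_divide simp: ax)
    then have "((\<lambda>t. p (x + axis i t) / p x) \<longlongrightarrow> 1) (nhds 0)"
      using assms(2) tendsto_at_iff_tendsto_nhds[of "\<lambda>t. p (x + axis i t) / p x" 0]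
      by (simp add: ax isCont_def)
    moreover have "open (- (\<real>\<^sub>\<le>\<^sub>0 :: complex set))" by (simp add: closed_nonpos_Reals_complex open_Compl)
    ultimately show ?thesis by (auto dest!: topological_tendstoD)
  qed
  show ?thesis unfolding hessian_log_def hessian_def vec_lambda_beta
    unfolding partial_def[of i]
    by (rule deriv_cong_ev[OF _ refl]) (use ev in \<open>auto elim!: eventually_mono simp: *\<close>)
qed

definition homogeneous_function :: "int \<Rightarrow> (complex ^ 'n \<Rightarrow> complex) \<Rightarrow> bool" where
  "homogeneous_function d f \<longleftrightarrow> (\<forall>c x. c \<noteq> 0 \<longrightarrow> f (c *s x) = c powi d * f x)"

definition nondegenerate_log_hessian :: "(complex ^ 'n \<Rightarrow> complex) \<Rightarrow> bool" where
  "nondegenerate_log_hessian f \<longleftrightarrow> (\<exists>x. f x \<noteq> 0 \<and> Determinants.det (hessian_log f x) \<noteq> 0)"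

text \<open>A relation, since the transform is in general only determined on an open cone.\<close>

definition is_multiplicative_legendre_transform ::
    "(complex ^ 'n \<Rightarrow> complex) \<Rightarrow> (complex ^ 'n \<Rightarrow> complex) \<Rightarrow> bool" where
  "is_multiplicative_legendre_transform f g \<longleftrightarrow>
    (\<exists>d. homogeneous_function d g) \<and>
    (\<exists>U. open U \<and> U \<noteq> {} \<and>
      (\<forall>x\<in>U. f x \<noteq> 0 \<and> g (inverse (f x) *s differential f x) = 1 / f x))"

definition EKP_homaloidal :: "(complex ^ 'n \<Rightarrow> complex) \<Rightarrow> bool" where
  "EKP_homaloidal f \<longleftrightarrow>
    f \<in> polynomial_functions \<and> (\<exists>d. homogeneous_function d f) \<and>
    nondegenerate_log_hessian f \<and>
    (\<exists>g \<in> polynomial_functions. is_multiplicative_legendre_transform f g)"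

definition GL :: "nat \<Rightarrow> complex mat monoid" where
  "GL m = units_of (ring_mat TYPE(complex) m ())"

lemma carrier_GL: "carrier (GL m) = {A \<in> carrier_mat m m. Determinant.det A \<noteq> 0}"
proof -
  have "A \<in> carrier (GL m) \<longleftrightarrow> A \<in> carrier_mat m m \<and> Determinant.det A \<noteq> 0" for A
    unfolding GL_def units_of_def
    using det_non_zero_imp_unit[of A m] unit_imp_det_non_zero[of A m "()"]
    by (auto simp: Units_def ring_mat_simps)
  then show ?thesis by auto
qed

definition regular_functions_GL :: "nat \<Rightarrow> (complex mat \<Rightarrow> complex) set" where
  "regular_functions_GL m = generated_algebra
    ({\<lambda>A. A $$ (i, j) | i j. i < m \<and> j < m} \<union> {\<lambda>A. inverse (Determinant.det A)})"

definition zariski_GL :: "nat \<Rightarrow> complex mat topology" where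
  "zariski_GL m = zariski (carrier (GL m)) (regular_functions_GL m)"

definition zariski_V :: "(complex ^ 'n) topology" where
  "zariski_V = zariski UNIV polynomial_functions"

definition linear_algebraic_group :: "nat \<Rightarrow> complex mat set \<Rightarrow> bool" where
  "linear_algebraic_group m G \<longleftrightarrow> subgroup G (GL m) \<and> closedin (zariski_GL m) G"

text \<open>\<open>G\<close> being closed in \<open>GL m\<close>, its regular functions are the restrictions of those on \<open>GL m\<close>.\<close>

definition regular_on :: "nat \<Rightarrow> complex mat set \<Rightarrow> (complex mat \<Rightarrow> complex) \<Rightarrow> bool" where
  "regular_on m G \<phi> \<longleftrightarrow> (\<exists>p \<in> regular_functions_GL m. \<forall>A\<in>G. \<phi> A = p A)"

definition rational_representation ::
    "nat \<Rightarrow> complex mat set \<Rightarrow> (complex mat \<Rightarrow> complex ^ 'n ^ 'n) \<Rightarrow> bool" where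
  "rational_representation m G \<rho> \<longleftrightarrow>
    \<rho> (1\<^sub>m m) = Finite_Cartesian_Product.mat 1 \<and>
    (\<forall>A\<in>G. \<forall>B\<in>G. \<rho> (A * B) = \<rho> A ** \<rho> B) \<and>
    (\<forall>i j. regular_on m G (\<lambda>A. \<rho> A $ i $ j))"

definition rational_character :: "nat \<Rightarrow> complex mat set \<Rightarrow> (complex mat \<Rightarrow> complex) \<Rightarrow> bool" where
  "rational_character m G \<eta> \<longleftrightarrow>
    \<eta> (1\<^sub>m m) = 1 \<and> (\<forall>A\<in>G. \<forall>B\<in>G. \<eta> (A * B) = \<eta> A * \<eta> B) \<and> regular_on m G \<eta>"

definition irreducible_representation ::
    "complex mat set \<Rightarrow> (complex mat \<Rightarrow> complex ^ 'n ^ 'n) \<Rightarrow> bool" where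
  "irreducible_representation G \<rho> \<longleftrightarrow>
    (\<forall>W. vec.subspace W \<and> (\<forall>A\<in>G. \<forall>w\<in>W. \<rho> A *v w \<in> W) \<longrightarrow> W = {0} \<or> W = UNIV)"

definition rep_orbit ::
    "complex mat set \<Rightarrow> (complex mat \<Rightarrow> complex ^ 'n ^ 'n) \<Rightarrow> complex ^ 'n \<Rightarrow> (complex ^ 'n) set" where
  "rep_orbit G \<rho> v = {\<rho> A *v v | A. A \<in> G}"

definition rep_stabilizer ::
    "complex mat set \<Rightarrow> (complex mat \<Rightarrow> complex ^ 'n ^ 'n) \<Rightarrow> complex ^ 'n \<Rightarrow> complex mat set" where
  "rep_stabilizer G \<rho> v = {A \<in> G. \<rho> A *v v = v}"

definition has_dense_open_orbit ::
    "complex mat set \<Rightarrow> (complex mat \<Rightarrow> complex ^ 'n ^ 'n) \<Rightarrow> complex ^ 'n \<Rightarrow> bool" where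
  "has_dense_open_orbit G \<rho> v \<longleftrightarrow>
    openin zariski_V (rep_orbit G \<rho> v) \<and> Abstract_Topology.closure_of zariski_V (rep_orbit G \<rho> v) = UNIV"

definition prehomogeneous_vector_space ::
    "nat \<Rightarrow> complex mat set \<Rightarrow> (complex mat \<Rightarrow> complex ^ 'n ^ 'n) \<Rightarrow> bool" where
  "prehomogeneous_vector_space m G \<rho> \<longleftrightarrow>
    linear_algebraic_group m G \<and> rational_representation m G \<rho> \<and>
    (\<exists>v. has_dense_open_orbit G \<rho> v)"

definition relative_invariant ::
    "nat \<Rightarrow> complex mat set \<Rightarrow> (complex mat \<Rightarrow> complex ^ 'n ^ 'n) \<Rightarrow> (complex ^ 'n \<Rightarrow> complex) \<Rightarrow> bool" where
  "relative_invariant m G \<rho> f \<longleftrightarrow>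
    f \<in> polynomial_functions \<and> f \<noteq> (\<lambda>_. 0) \<and>
    (\<exists>\<eta>. rational_character m G \<eta> \<and> (\<forall>A\<in>G. \<forall>x. f (\<rho> A *v x) = \<eta> A * f x))"

text \<open>A regular automorphism of order exactly two.\<close>

definition group_involution :: "nat \<Rightarrow> complex mat set \<Rightarrow> (complex mat \<Rightarrow> complex mat) \<Rightarrow> bool" where
  "group_involution m G \<sigma> \<longleftrightarrow>
    \<sigma> \<in> hom (GL m\<lparr>carrier := G\<rparr>) (GL m\<lparr>carrier := G\<rparr>) \<and>
    (\<forall>i<m. \<forall>j<m. regular_on m G (\<lambda>A. \<sigma> A $$ (i, j))) \<and>
    (\<forall>A\<in>G. \<sigma> (\<sigma> A) = A) \<and> (\<exists>A\<in>G. \<sigma> A \<noteq> A)"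

definition fixed_points :: "complex mat set \<Rightarrow> (complex mat \<Rightarrow> complex mat) \<Rightarrow> complex mat set" where
  "fixed_points G \<sigma> = {A \<in> G. \<sigma> A = A}"

definition identity_component :: "nat \<Rightarrow> complex mat set \<Rightarrow> complex mat set" where
  "identity_component m H = connected_component_of_set (subtopology (zariski_GL m) H) (1\<^sub>m m)"

definition prehomogeneous_symmetric_space ::
    "nat \<Rightarrow> complex mat set \<Rightarrow> (complex mat \<Rightarrow> complex ^ 'n ^ 'n) \<Rightarrow> bool" where
  "prehomogeneous_symmetric_space m G \<rho> \<longleftrightarrow>
    prehomogeneous_vector_space m G \<rho> \<and>
    (\<exists>\<sigma> v. group_involution m G \<sigma> \<and> has_dense_open_orbit G \<rho> v \<and>
      rep_stabilizer G \<rho> v \<subseteq> fixed_points G \<sigma> \<and>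
      identity_component m (fixed_points G \<sigma>) \<subseteq> rep_stabilizer G \<rho> v)"

end

(*
  Let N be the cubic form f, N' its Legendre transform, x# = df(x) the differential and x \<times> y its
  polarization. EKP-homaloidality gives first N'(x#) = N(x)^2 and then, as x# is generically a local
  isomorphism, the adjoint identities x## = N(x) x on both sides. From these the operators
  U_a y = <a,y> a - a# \<times> y satisfy N(U_a y) = N(a)^2 N'(y) and U_a U_{a#} = N(a)^2. Hence the group of
  linear similitudes of N contains all invertible U_a U_b; the orbit map a \<mapsto> U_a x# has derivative
  2 N(x) at x, so orbits in {N \<noteq> 0} are open, and {N \<noteq> 0} is connected: one orbit. For N(c) = 1 the
  involution is A \<mapsto> U_c A^{-T} U_c^{-1}. It fixes A iff U_{Ac} = U_c, which forces Ac = c unless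
  <Ac,c#> takes one of the values -3, 1, -1, so the stabilizer of c is open and closed in the fixed group.
  An invariant subspace W meets its orthogonal complement trivially for the form <x, U_{c#} y>, and the
  splitting V = W + W^\<bottom> forces one summand to be a line and N to be a linear times a quadratic form.
*)
theory Submission
  imports Defs
begin

section \<open>Cubic forms and the adjoint identity\<close>

text \<open>The model is the determinant on symmetric 3 by 3 matrices, the dual being identified
  through the trace: there x# is the adjugate and U_a y is a y a. No Jordan product or unit is
  needed, since U maps the dual to the space; a base point c enters for the involution, which is the
  dual action carried back to V by U_c. The main obstacle is that # is not known to be onto.
  Identities for U and for similitudes are first proved at vectors z#. Every vector of nonzero norm
  is of this kind, and the zero locus is reached by an invertibility argument that passes again
  through nonzero norms. The values -3, 1, -1 and the regular value 3 are the sums of three signs: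
  e^2 = 1 leaves e with three eigenvalues 1 or -1, and <e, c#> is their sum. A summand becomes a
  line because # vanishes on it: there <v, U_{c#} v> is the square of the linear form <v, c#>, and
  the form is nondegenerate. The pairing \<open>pr\<close> is bilinear, not Hermitian: it evaluates
  linear forms.\<close>

definition pr :: "complex ^ 'n \<Rightarrow> complex ^ 'n \<Rightarrow> complex" where
  "pr x y = (\<Sum>i\<in>UNIV. x $ i * y $ i)"

lemma pr_commute: "pr x y = pr y x"
  by (simp add: pr_def mult.commute)

lemma pr_add_left: "pr (x + y) z = pr x z + pr y z"
  by (simp add: pr_def sum.distrib algebra_simps)

lemma pr_add_right: "pr z (x + y) = pr z x + pr z y"
  by (simp add: pr_def sum.distrib algebra_simps)

lemma pr_scale_left: "pr (c *s x) y = c * pr x y"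
  by (simp add: pr_def sum_distrib_left mult.assoc)

lemma pr_scale_right: "pr x (c *s y) = c * pr x y"
  by (simp add: pr_def sum_distrib_left mult.left_commute)

lemma pr_diff_left: "pr (x - y) z = pr x z - pr y z"
  by (simp add: pr_def sum_subtractf algebra_simps)

lemma pr_diff_right: "pr z (x - y) = pr z x - pr z y"
  by (simp add: pr_def sum_subtractf algebra_simps)

lemma pr_minus_left: "pr (- x) z = - pr x z"
  by (simp add: pr_def sum_negf)

lemma pr_minus_right: "pr z (- x) = - pr z x"
  by (simp add: pr_def sum_negf)

lemma pr_zero [simp]: "pr 0 z = 0" "pr z 0 = 0"
  by (simp_all add: pr_def)

lemmas pr_linear = pr_add_left pr_add_right pr_scale_left pr_scale_right pr_diff_left pr_diff_right
  pr_minus_left pr_minus_right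

lemma pr_axis_left [simp]: "pr (axis i c) y = c * y $ i"
proof -
  have "pr (axis i c) y = (\<Sum>j\<in>UNIV. if j = i then c * y $ i else 0)"
    unfolding pr_def by (rule sum.cong) (auto simp: axis_def)
  then show ?thesis by simp
qed

lemma pr_axis_right [simp]: "pr y (axis i c) = y $ i * c"
  by (simp add: pr_commute[of y] mult.commute)

lemma pr_eqI: "(\<And>z. pr z x = pr z y) \<Longrightarrow> x = y"
  by (metis pr_axis_left mult_1 Finite_Cartesian_Product.vec_eq_iff)

lemma functional_eq_pr:
  fixes l :: "complex ^ 'n \<Rightarrow> complex"
  assumes "\<And>x y. l (x + y) = l x + l y" "\<And>c x. l (c *s x) = c * l x"
  shows "l z = pr z (\<chi> i. l (axis i 1))"
proof -
  have "l 0 = 0" using assms(2)[of 0 0] by simp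
  then have "l (sum g A) = (\<Sum>i\<in>A. l (g i))" for g and A :: "'n set"
    by (induction A rule: infinite_finite_induct) (simp_all add: assms(1))
  then have "l (\<Sum>i\<in>UNIV. z $ i *s axis i 1) = (\<Sum>i\<in>UNIV. z $ i * l (axis i 1))"
    by (simp add: assms(2))
  then show ?thesis unfolding basis_expansion pr_def by simp
qed

text \<open>
  A cubic form \<open>N\<close> is represented by its full polarization \<open>F\<close>, so \<open>nrm F x\<close> is \<open>N(x)\<close>, while \<open>shp F x\<close>
  and \<open>crs F x y\<close> are the adjoint \<open>x#\<close> and its polarization \<open>x \<times> y\<close> in the theory of cubic Jordan algebras.
\<close>

definition crs :: "(complex ^ 'n \<Rightarrow> complex ^ 'n \<Rightarrow> complex ^ 'n \<Rightarrow> complex) \<Rightarrow>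
    complex ^ 'n \<Rightarrow> complex ^ 'n \<Rightarrow> complex ^ 'n" where
  "crs F x y = (\<chi> i. F x y (axis i 1))"

definition shp :: "(complex ^ 'n \<Rightarrow> complex ^ 'n \<Rightarrow> complex ^ 'n \<Rightarrow> complex) \<Rightarrow>
    complex ^ 'n \<Rightarrow> complex ^ 'n" where
  "shp F x = (1 / 2) *s crs F x x"

definition nrm :: "(complex ^ 'n \<Rightarrow> complex ^ 'n \<Rightarrow> complex ^ 'n \<Rightarrow> complex) \<Rightarrow>
    complex ^ 'n \<Rightarrow> complex" where
  "nrm F x = F x x x / 6"

text \<open>For Jordan algebras this is the operator \<open>U\<close>; it maps the dual space to the space.\<close>

definition uop :: "(complex ^ 'n \<Rightarrow> complex ^ 'n \<Rightarrow> complex ^ 'n \<Rightarrow> complex) \<Rightarrow>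
    (complex ^ 'n \<Rightarrow> complex ^ 'n \<Rightarrow> complex ^ 'n \<Rightarrow> complex) \<Rightarrow>
    complex ^ 'n \<Rightarrow> complex ^ 'n \<Rightarrow> complex ^ 'n" where
  "uop F H a y = pr a y *s a - crs H (shp F a) y"

text \<open>\<open>F\<close> is the third derivative of N, that is 3! times its normalized
  polarization. Hence the factors 1/6 in \<open>nrm\<close> and 1/2 in \<open>shp\<close>, which
  make \<open>shp F\<close> exactly the differential of \<open>nrm F\<close>.\<close>

locale cubic_form =
  fixes F :: "complex ^ 'n \<Rightarrow> complex ^ 'n \<Rightarrow> complex ^ 'n \<Rightarrow> complex"
  assumes swap12: "F x y z = F y x z"
    and swap23: "F x y z = F x z y"
    and add1: "F (x + x') y z = F x y z + F x' y z"
    and scale1: "F (c *s x) y z = c * F x y z"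
begin

lemma add2: "F x (y + y') z = F x y z + F x y' z"
  by (metis swap12 add1)

lemma add3: "F x y (z + z') = F x y z + F x y z'"
  by (metis swap23 add2)

lemma scale2: "F x (c *s y) z = c * F x y z"
  by (metis swap12 scale1)

lemma scale3: "F x y (c *s z) = c * F x y z"
  by (metis swap23 scale2)

lemma pr_crs: "pr z (crs F x y) = F x y z"
  unfolding crs_def using functional_eq_pr[of "F x y" z] by (simp add: add3 scale3)

lemma crs_commute: "crs F x y = crs F y x"
  by (simp add: crs_def swap12)

lemma pr_crs_rotate: "pr z (crs F x y) = pr y (crs F x z)"
  unfolding pr_crs by (rule swap23)

lemma crs_add_left: "crs F (x + x') y = crs F x y + crs F x' y"
  by (simp add: Finite_Cartesian_Product.vec_eq_iff crs_def add1)

lemma crs_add_right: "crs F y (x + x') = crs F y x + crs F y x'"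
  by (simp add: Finite_Cartesian_Product.vec_eq_iff crs_def add2)

lemma crs_scale_left: "crs F (c *s x) y = c *s crs F x y"
  by (simp add: Finite_Cartesian_Product.vec_eq_iff crs_def scale1)

lemma crs_scale_right: "crs F y (c *s x) = c *s crs F y x"
  by (simp add: Finite_Cartesian_Product.vec_eq_iff crs_def scale2)

lemma crs_diff_left: "crs F (x - x') y = crs F x y - crs F x' y"
  using crs_add_left[of x "(-1) *s x'" y] crs_scale_left[of "-1" x' y]
  by (simp add: vector_sneg_minus1[symmetric])

lemma crs_diff_right: "crs F y (x - x') = crs F y x - crs F y x'"
  using crs_diff_left crs_commute by metis

lemma crs_minus_left: "crs F (- x) y = - crs F x y"
  using crs_scale_left[of "-1" x y] by (simp add: vector_sneg_minus1[symmetric])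

lemma crs_minus_right: "crs F y (- x) = - crs F y x"
  using crs_minus_left crs_commute by metis

lemma crs_zero_left: "crs F 0 y = 0"
  using crs_scale_left[of 0 0 y] by simp

lemma crs_zero_right: "crs F y 0 = 0"
  using crs_zero_left crs_commute by metis

lemmas crs_linear = crs_add_left crs_add_right crs_scale_left crs_scale_right crs_diff_left
  crs_diff_right crs_minus_left crs_minus_right crs_zero_left crs_zero_right

lemma crs_self: "crs F x x = 2 *s shp F x"
  by (simp add: shp_def vector_smult_assoc)

lemma pr_crs_same: "pr x (crs F x y) = 2 * pr y (shp F x)"
  by (metis crs_self pr_crs_rotate pr_scale_right)

lemma pr_shp: "pr x (shp F x) = 3 * nrm F x"
  by (simp add: shp_def nrm_def pr_scale_right pr_crs)

lemma shp_scale: "shp F (c *s x) = c\<^sup>2 *s shp F x"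
  by (simp add: shp_def crs_linear vector_smult_assoc power2_eq_square mult.commute mult.left_commute)

lemma nrm_scale: "nrm F (c *s x) = c ^ 3 * nrm F x"
  by (simp add: nrm_def scale1 scale2 scale3 power3_eq_cube)

lemma shp_add: "shp F (x + y) = shp F x + crs F x y + shp F y"
  by (simp add: shp_def crs_linear crs_commute[of y x]) (simp add: Finite_Cartesian_Product.vec_eq_iff field_simps)

lemma nrm_add: "nrm F (x + y) = nrm F x + pr y (shp F x) + pr x (shp F y) + nrm F y"
proof -
  have "3 * nrm F (x + y) = pr (x + y) (shp F x + crs F x y + shp F y)"
    by (simp add: pr_shp[symmetric] shp_add)
  also have "\<dots> = 3 * nrm F x + 3 * pr y (shp F x) + 3 * pr x (shp F y) + 3 * nrm F y"
    using pr_crs_same[of y x] by (simp add: pr_linear pr_shp pr_crs_same crs_commute[of x y])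
      (simp add: crs_commute[of y x] pr_crs_same)
  finally have "3 * nrm F (x + y) = 3 * (nrm F x + pr y (shp F x) + pr x (shp F y) + nrm F y)"
    by (simp add: algebra_simps)
  then show ?thesis by (simp only: mult_cancel_left) simp
qed

lemma shp_zero [simp]: "shp F 0 = 0"
  by (simp add: shp_def crs_linear)

lemma nrm_zero [simp]: "nrm F 0 = 0"
  using nrm_scale[of 0 0] by simp

end

lemma quartic_coeffs:
  fixes a0 a1 a2 a3 a4 b0 b1 b2 b3 b4 :: complex
  assumes "\<And>t. a0 + t * a1 + t\<^sup>2 * a2 + t ^ 3 * a3 + t ^ 4 * a4 =
    b0 + t * b1 + t\<^sup>2 * b2 + t ^ 3 * b3 + t ^ 4 * b4"
  shows "a1 = b1" "a2 = b2"
proof -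
  have "poly [:a0 - b0, a1 - b1, a2 - b2, a3 - b3, a4 - b4:] t = 0" for t
    using assms[of t] by (simp add: algebra_simps eval_nat_numeral)
  then have "[:a0 - b0, a1 - b1, a2 - b2, a3 - b3, a4 - b4:] = 0"
    using poly_all_0_iff_0 by blast
  then show "a1 = b1" "a2 = b2" by simp_all
qed

locale adjoint_pair = A: cubic_form F + B: cubic_form H for F H +
  assumes adj: "shp H (shp F x) = nrm F x *s x"
    and adj': "shp F (shp H y) = nrm H y *s y"
begin

text \<open>Lets every later result be read with space and dual exchanged; such instances carry the
  prefix \<open>D\<close>.\<close>

lemma dual: "adjoint_pair H F"
  by unfold_locales (simp_all add: adj adj')

lemma nrm_shp: "nrm H (shp F x) = (nrm F x)\<^sup>2"
proof -
  have "3 * nrm H (shp F x) = pr (shp F x) (nrm F x *s x)"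
    by (simp add: B.pr_shp[symmetric] adj)
  also have "\<dots> = nrm F x * (3 * nrm F x)"
    by (simp add: pr_linear pr_commute[of _ x] A.pr_shp)
  finally show ?thesis by (simp add: power2_eq_square)
qed

text \<open>Coefficients of t and t^2 in \<open>adj\<close> at x + t z, where both sides have degree
  at most four in t.\<close>

lemma adj_linearized:
  "crs H (shp F x) (crs F x z) = nrm F x *s z + pr z (shp F x) *s x" (is ?L1)
  "crs H (shp F x) (shp F z) + shp H (crs F x z) = pr z (shp F x) *s z + pr x (shp F z) *s x" (is ?L2)
proof -
  let ?a = "shp F x" and ?b = "crs F x z" and ?c = "shp F z"
  have shp_t: "shp F (x + t *s z) = ?a + (t *s ?b + t\<^sup>2 *s ?c)" for t
    by (simp add: A.shp_add A.shp_scale A.crs_linear)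
  have "shp H ?a $ i + t * crs H ?a ?b $ i + t\<^sup>2 * (crs H ?a ?c + shp H ?b) $ i
      + t ^ 3 * crs H ?b ?c $ i + t ^ 4 * shp H ?c $ i
    = nrm F x * x $ i + t * (nrm F x *s z + pr z ?a *s x) $ i
      + t\<^sup>2 * (pr z ?a *s z + pr x ?c *s x) $ i
      + t ^ 3 * (pr x ?c * z $ i + nrm F z * x $ i) + t ^ 4 * (nrm F z * z $ i)" for t i
  proof -
    have "shp H (shp F (x + t *s z)) = nrm F (x + t *s z) *s (x + t *s z)" by (rule adj)
    then have "shp H (shp F (x + t *s z)) $ i = (nrm F (x + t *s z) *s (x + t *s z)) $ i" by simp
    then show ?thesis
      unfolding shp_t B.shp_add B.shp_scale B.crs_linear A.nrm_add A.nrm_scale A.shp_scale pr_linear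
      by (simp add: algebra_simps eval_nat_numeral)
  qed
  from quartic_coeffs[OF this] show ?L1 ?L2 unfolding Finite_Cartesian_Product.vec_eq_iff by blast+
qed

lemmas adj1 = adj_linearized(1)
lemmas adj2 = adj_linearized(2)

end

section \<open>The U operators\<close>

context adjoint_pair begin

text \<open>The transpose of \<open>adj1\<close>: both cross product operators are symmetric for
  \<open>pr\<close>, so transposing reverses their order.\<close>

lemma crs_crs: "crs F x (crs H (shp F x) y) = nrm F x *s y + pr x y *s shp F x"
proof (rule pr_eqI)
  fix z
  have "pr z (crs F x (crs H (shp F x) y)) = pr y (crs H (shp F x) (crs F x z))"
    by (simp only: A.pr_crs_rotate[of z x] pr_commute[of "crs H (shp F x) y"] B.pr_crs_rotate[of _ _ y])
  also have "\<dots> = pr z (nrm F x *s y + pr x y *s shp F x)"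
    by (simp add: adj1 pr_linear pr_commute[of y])
  finally show "pr z (crs F x (crs H (shp F x) y)) = pr z (nrm F x *s y + pr x y *s shp F x)" .
qed

lemma pr_crs_crs:
  "pr (crs F a z) (crs H (shp F a) (shp F z)) =
    3 * nrm F a * nrm F z + pr z (shp F a) * pr a (shp F z)"
proof -
  have "pr (crs F a z) (crs H (shp F a) (shp F z)) = pr (shp F z) (crs H (shp F a) (crs F a z))"
    by (rule B.pr_crs_rotate)
  then show ?thesis by (simp add: adj1 pr_linear pr_commute[of "shp F z"] A.pr_shp)
qed

text \<open>Euler's relation 3 N'(w) = <w, w#> for w = a \<times> z, with w# taken from
  \<open>adj2\<close>.\<close>

lemma nrm_crs: "nrm H (crs F a z) = pr z (shp F a) * pr a (shp F z) - nrm F a * nrm F z"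
proof -
  have "shp H (crs F a z) =
      pr z (shp F a) *s z + pr a (shp F z) *s a - crs H (shp F a) (shp F z)"
    using adj2[of a z] by (simp add: algebra_simps)
  then have "3 * nrm H (crs F a z) = pr z (shp F a) * pr z (crs F a z)
      + pr a (shp F z) * pr a (crs F a z) - pr (crs F a z) (crs H (shp F a) (shp F z))"
    by (simp add: B.pr_shp[symmetric] pr_linear pr_commute[of "crs F a z"])
  also have "pr z (crs F a z) = 2 * pr a (shp F z)"
    using A.pr_crs_same[of z a] by (simp only: A.crs_commute[of z a])
  also have "pr a (crs F a z) = 2 * pr z (shp F a)"
    by (rule A.pr_crs_same)
  finally have "3 * nrm H (crs F a z) =
      3 * (pr z (shp F a) * pr a (shp F z) - nrm F a * nrm F z)"
    unfolding pr_crs_crs by (simp add: algebra_simps)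
  then show ?thesis by (simp only: mult_cancel_left) simp
qed

text \<open>Brings in (a \<times> z)#, a vector to which \<open>adj'\<close> can be applied.\<close>

lemma uop_shp: "uop F H a (shp F z) = shp H (crs F a z) - pr z (shp F a) *s z"
  using adj2[of a z] by (simp add: uop_def algebra_simps)

lemma uop_adj: "uop H F (shp F a) z = pr z (shp F a) *s shp F a - nrm F a *s crs F a z"
  by (simp add: uop_def adj A.crs_linear pr_commute)

text \<open>The case y = z# of the Jordan identity (U_a y)# = U_{a#} y#, where y# = N(z) z.\<close>

lemma shp_uop_shp: "shp F (uop F H a (shp F z)) = nrm F z *s uop H F (shp F a) z"
proof -
  let ?s = "pr z (shp F a)" and ?t = "pr a (shp F z)"
  have "crs F (crs H (shp F a) (shp F z)) z = nrm F z *s shp F a + ?s *s shp F z"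
    using crs_crs[of z "shp F a"]
    by (simp only: A.crs_commute[of z] B.crs_commute[of "shp F z"])
  moreover have "shp H (crs F a z) = ?s *s z + ?t *s a - crs H (shp F a) (shp F z)"
    using adj2[of a z] by (simp add: algebra_simps)
  ultimately have "crs F (shp H (crs F a z)) z = ?s *s (2 *s shp F z) + ?t *s crs F a z
      - (nrm F z *s shp F a + ?s *s shp F z)"
    by (simp add: A.crs_linear A.crs_self)
  then have 1: "crs F (shp H (crs F a z)) z =
      ?s *s shp F z - nrm F z *s shp F a + ?t *s crs F a z"
    by (simp add: Finite_Cartesian_Product.vec_eq_iff algebra_simps)
  \<comment> \<open>Expanding # at this sum, \<open>adj'\<close> turns the first square into N'(a
    \<times> z) a \<times> z, and \<open>nrm_crs\<close> evaluates the coefficient.\<close>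
  have "shp F (uop F H a (shp F z)) = shp F (shp H (crs F a z) + (- ?s) *s z)"
    unfolding uop_shp by (simp add: Finite_Cartesian_Product.vec_eq_iff)
  also have "\<dots> = nrm H (crs F a z) *s crs F a z - ?s *s crs F (shp H (crs F a z)) z + ?s\<^sup>2 *s shp F z"
    unfolding A.shp_add A.shp_scale A.crs_linear adj'
    by (simp add: Finite_Cartesian_Product.vec_eq_iff)
  also have "\<dots> = nrm F z *s uop H F (shp F a) z"
    unfolding 1 uop_adj nrm_crs
    by (simp add: Finite_Cartesian_Product.vec_eq_iff algebra_simps power2_eq_square)
  finally show ?thesis .
qed

text \<open>Euler's relation 3 N(u) = <u, u#> at u = U_a z#, with u# known from
  \<open>shp_uop_shp\<close>.\<close>

lemma nrm_uop_shp: "nrm F (uop F H a (shp F z)) = (nrm F a)\<^sup>2 * nrm H (shp F z)"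
proof -
  let ?s = "pr z (shp F a)" and ?t = "pr a (shp F z)"
  have 1: "pr a (crs F a z) = 2 * ?s" by (rule A.pr_crs_same)
  have 2: "pr (shp F a) (crs H (shp F a) (shp F z)) = 2 * nrm F a * ?t"
    by (simp add: B.pr_crs_same adj pr_linear pr_commute[of _ a])
  have "3 * nrm F (uop F H a (shp F z)) =
      nrm F z * pr (uop F H a (shp F z)) (uop H F (shp F a) z)"
    by (simp add: A.pr_shp[symmetric] shp_uop_shp pr_linear)
  also have "\<dots> = nrm F z * (?t * ?s * (3 * nrm F a) - ?t * nrm F a * (2 * ?s)
      - ?s * (2 * nrm F a * ?t) + nrm F a * (3 * nrm F a * nrm F z + ?s * ?t))"
    unfolding uop_adj unfolding uop_def
    by (simp add: pr_linear A.pr_shp 1 pr_commute[of "crs H _ _"] 2 pr_crs_crs)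
       (simp add: algebra_simps)
  also have "\<dots> = 3 * ((nrm F a)\<^sup>2 * nrm H (shp F z))"
    by (simp add: nrm_shp power2_eq_square algebra_simps)
  finally show ?thesis by simp
qed

text \<open>As y## = N'(y) y and # is quadratic, a square root of 1 / N'(y) rescales y# to a
  preimage of y.\<close>

lemma shp_surj:
  assumes "nrm H y \<noteq> 0"
  obtains x where "y = shp F x"
proof -
  define s where "s = csqrt (1 / nrm H y)"
  have "s\<^sup>2 = 1 / nrm H y" unfolding s_def by (rule power2_csqrt)
  then have "shp F (s *s shp H y) = y"
    using assms by (simp add: A.shp_scale adj' vector_smult_assoc)
  then show ?thesis by (rule that[OF sym])
qed

lemma uop_uop_shp: "uop F H a (uop H F (shp F a) x) = (nrm F a)\<^sup>2 *s x"
proof -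
  have 1: "pr a (crs F a x) = 2 * pr x (shp F a)" by (rule A.pr_crs_same)
  have 2: "crs H (shp F a) (shp F a) = (2 * nrm F a) *s a"
    by (simp add: B.crs_self adj vector_smult_assoc)
  show ?thesis
    unfolding uop_adj unfolding uop_def pr_linear 1 A.pr_shp B.crs_linear 2 adj1
    by (simp add: Finite_Cartesian_Product.vec_eq_iff algebra_simps power2_eq_square)
qed

text \<open>The dual identity at a# reads U_{a#} U_{a##} = N'(a#)^2 = N(a)^4. As a## = N(a) a and U
  is quadratic in its base, a factor N(a)^2 cancels.\<close>

lemma uop_uop_shp':
  assumes "nrm F a \<noteq> 0"
  shows "uop H F (shp F a) (uop F H a y) = (nrm F a)\<^sup>2 *s y"
proof -
  interpret D: adjoint_pair H F by (rule dual)
  have "uop F H (c *s a) y = c\<^sup>2 *s uop F H a y" for c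
    by (simp add: uop_def A.shp_scale B.crs_linear pr_linear power2_eq_square
      Finite_Cartesian_Product.vec_eq_iff algebra_simps)
  moreover have "uop H F b (c *s y) = c *s uop H F b y" for b c y
    by (simp add: uop_def A.crs_linear pr_linear Finite_Cartesian_Product.vec_eq_iff algebra_simps)
  ultimately have "(nrm F a)\<^sup>2 *s uop H F (shp F a) (uop F H a y) = ((nrm F a)\<^sup>2)\<^sup>2 *s y"
    using D.uop_uop_shp[of "shp F a" y] by (simp add: adj nrm_shp)
  then show ?thesis using assms by (simp add: Finite_Cartesian_Product.vec_eq_iff power2_eq_square)
qed

lemma nrm_uop:
  assumes "nrm F a \<noteq> 0"
  shows "nrm F (uop F H a y) = (nrm F a)\<^sup>2 * nrm H y"
proof (cases "nrm H y = 0")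
  case False
  then obtain z where "y = shp F z" by (rule shp_surj)
  then show ?thesis by (simp add: nrm_uop_shp)
next
  case True
  interpret D: adjoint_pair H F by (rule dual)
  have "nrm F (uop F H a y) = 0"
  proof (rule ccontr)
    \<comment> \<open>Then U_a y is some w#, so applying U_{a#} keeps the norm nonzero; but the
      result is N(a)^2 y, of norm zero.\<close>
    assume *: "nrm F (uop F H a y) \<noteq> 0"
    then obtain w where w: "uop F H a y = shp H w" by (rule D.shp_surj)
    have "nrm H (uop H F (shp F a) (uop F H a y)) = (nrm H (shp F a))\<^sup>2 * nrm F (uop F H a y)"
      unfolding w by (rule D.nrm_uop_shp)
    then show False using True * assms by (simp add: uop_uop_shp' B.nrm_scale nrm_shp)
  qed
  then show ?thesis using True by simp
qed

lemma uop_add: "uop F H a (y + z) = uop F H a y + uop F H a z"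
  by (simp add: uop_def B.crs_linear pr_linear Finite_Cartesian_Product.vec_eq_iff algebra_simps)

lemma uop_scale: "uop F H a (c *s y) = c *s uop F H a y"
  by (simp add: uop_def B.crs_linear pr_linear Finite_Cartesian_Product.vec_eq_iff algebra_simps)

lemma uop_zero: "uop F H a 0 = 0"
  using uop_scale[of a 0 0] by simp

lemma uop_diff: "uop F H a (y - z) = uop F H a y - uop F H a z"
  by (simp add: uop_def B.crs_linear pr_linear Finite_Cartesian_Product.vec_eq_iff algebra_simps)

lemma uop_symmetric: "pr z (uop F H a y) = pr y (uop F H a z)"
  using B.pr_crs_rotate[of z "shp F a" y]
  by (simp add: uop_def pr_linear pr_commute[of _ a] mult.commute)

lemma uop_scale_base: "uop F H (c *s a) y = c\<^sup>2 *s uop F H a y"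
  by (simp add: uop_def A.shp_scale B.crs_linear pr_linear power2_eq_square
      Finite_Cartesian_Product.vec_eq_iff algebra_simps)

lemma uop_shp_self: "uop F H a (shp F a) = nrm F a *s a"
  by (simp add: uop_def A.pr_shp B.crs_self adj vector_smult_assoc
      Finite_Cartesian_Product.vec_eq_iff algebra_simps)

end

context cubic_form begin

lemma polarization:
  "F x y z = nrm F (x + y + z) - nrm F (x + y) - nrm F (x + z) - nrm F (y + z)
    + nrm F x + nrm F y + nrm F z"
  by (simp add: nrm_add shp_add pr_linear pr_crs pr_commute[of "crs F _ _"] swap12 swap23)

end

section \<open>Similitudes and their action on the dual, on # and on U\<close>

definition similitude :: "(complex ^ 'n \<Rightarrow> complex ^ 'n \<Rightarrow> complex ^ 'n \<Rightarrow> complex) \<Rightarrow>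
    complex ^ 'n ^ 'n \<Rightarrow> complex \<Rightarrow> bool" where
  "similitude F A k \<longleftrightarrow> k \<noteq> 0 \<and> (\<forall>x. nrm F (A *v x) = k * nrm F x)"

text \<open>A relation characterizing B as the inverse transpose of A, so that no inverse matrix has
  to be written.\<close>

definition contragredient :: "complex ^ 'n ^ 'n \<Rightarrow> complex ^ 'n ^ 'n \<Rightarrow> bool" where
  "contragredient A B \<longleftrightarrow> (\<forall>x y. pr (A *v x) (B *v y) = pr x y)"

lemma pr_transpose: "pr (A *v x) y = pr x (Finite_Cartesian_Product.transpose A *v y)"
proof -
  have "pr (A *v x) y = (\<Sum>i\<in>UNIV. \<Sum>j\<in>UNIV. A $ i $ j * x $ j * y $ i)"
    by (simp add: pr_def matrix_vector_mult_def sum_distrib_right)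
  also have "\<dots> = (\<Sum>j\<in>UNIV. \<Sum>i\<in>UNIV. A $ i $ j * x $ j * y $ i)"
    by (rule sum.swap)
  also have "\<dots> = pr x (Finite_Cartesian_Product.transpose A *v y)"
    by (simp add: pr_def matrix_vector_mult_def sum_distrib_left
        Finite_Cartesian_Product.transpose_def mult_ac)
  finally show ?thesis .
qed

lemma contragredient_iff:
  "contragredient A B \<longleftrightarrow> Finite_Cartesian_Product.transpose A ** B = Finite_Cartesian_Product.mat 1"
proof
  assume "contragredient A B"
  then have "Finite_Cartesian_Product.transpose A *v (B *v y) = y" for y
    unfolding contragredient_def pr_transpose by (intro pr_eqI) simp
  then show "Finite_Cartesian_Product.transpose A ** B = Finite_Cartesian_Product.mat 1"
    by (simp add: matrix_eq matrix_vector_mul_assoc)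
next
  assume "Finite_Cartesian_Product.transpose A ** B = Finite_Cartesian_Product.mat 1"
  then show "contragredient A B"
    unfolding contragredient_def pr_transpose by (simp add: matrix_vector_mul_assoc)
qed

lemma contragredient_commute: "contragredient A B \<longleftrightarrow> contragredient B A"
proof -
  have "contragredient A B \<Longrightarrow> contragredient B A" for A B :: "complex ^ 'n ^ 'n"
    unfolding contragredient_def
  proof (intro allI)
    fix x y
    assume "\<forall>x y. pr (A *v x) (B *v y) = pr x y"
    then have "pr (A *v y) (B *v x) = pr y x" by blast
    then show "pr (B *v x) (A *v y) = pr x y" by (simp only: pr_commute[of x] pr_commute[of "B *v x"])
  qed
  then show ?thesis by blast
qed

lemma contragredient_surj:
  assumes "contragredient A B"
  obtains x where "w = A *v x"
proof -
  have "Finite_Cartesian_Product.transpose B ** A = Finite_Cartesian_Product.mat 1"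
    using assms contragredient_commute[of A B] contragredient_iff[of B A] by blast
  then have "A ** Finite_Cartesian_Product.transpose B = Finite_Cartesian_Product.mat 1"
    by (simp add: matrix_left_right_inverse)
  then have "w = A *v (Finite_Cartesian_Product.transpose B *v w)"
    by (simp add: matrix_vector_mul_assoc del: transpose_matrix_vector)
  then show ?thesis using that by blast
qed

lemma contragredient_inj:
  assumes "contragredient A B" "B *v y = B *v z"
  shows "y = z"
proof (rule pr_eqI)
  fix x
  have "pr x y = pr (A *v x) (B *v y)" "pr x z = pr (A *v x) (B *v z)"
    using assms(1) by (simp_all add: contragredient_def)
  then show "pr x y = pr x z" using assms(2) by simp
qed

context cubic_form begin

lemma similitude_trilinear:
  assumes "similitude F A k"
  shows "F (A *v x) (A *v y) (A *v z) = k * F x y z"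
proof -
  have k: "nrm F (A *v v) = k * nrm F v" for v
    using assms by (simp add: similitude_def)
  have add: "nrm F (A *v u + A *v v) = k * nrm F (u + v)" for u v
    using k[of "u + v"] by (simp only: matrix_vector_right_distrib)
  have "nrm F (A *v x + A *v y + A *v z) = k * nrm F (x + y + z)"
    using k[of "x + y + z"] by (simp only: matrix_vector_right_distrib)
  then show ?thesis
    by (simp only: polarization[of "A *v x"] polarization[of x] add k right_diff_distrib distrib_left)
qed

lemma similitude_crs:
  assumes "similitude F A k" "contragredient A B"
  shows "crs F (A *v x) (A *v y) = k *s (B *v crs F x y)"
proof (rule pr_eqI)
  fix w
  obtain z where z: "w = A *v z" using contragredient_surj[OF assms(2)] .
  have "pr z (crs F x y) = pr (A *v z) (B *v crs F x y)"
    using assms(2) by (simp add: contragredient_def)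
  then show "pr w (crs F (A *v x) (A *v y)) = pr w (k *s (B *v crs F x y))"
    unfolding z pr_crs similitude_trilinear[OF assms(1)] pr_linear by (simp add: pr_crs)
qed

lemma similitude_shp:
  assumes "similitude F A k" "contragredient A B"
  shows "shp F (A *v x) = k *s (B *v shp F x)"
  unfolding shp_def similitude_crs[OF assms]
  by (simp add: vec.scale vector_smult_assoc)

end

context adjoint_pair begin

text \<open>At y = x#, the rules (A x)# = k B x# and N'(x#) = N(x)^2 give k^3 N'(B y) = k^2
  N'(y).\<close>

lemma similitude_contragredient:
  assumes "similitude F A k" "contragredient A B"
  shows "similitude H B (1 / k)"
proof -
  have k: "k \<noteq> 0" "nrm F (A *v x) = k * nrm F x" for x
    using assms(1) by (auto simp: similitude_def)
  have *: "nrm H (B *v shp F x) = (1 / k) * nrm H (shp F x)" for x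
  proof -
    have "k ^ 3 * nrm H (B *v shp F x) = nrm H (shp F (A *v x))"
      by (simp add: A.similitude_shp[OF assms] B.nrm_scale)
    also have "\<dots> = k\<^sup>2 * nrm H (shp F x)"
      unfolding nrm_shp k(2) by (simp add: power_mult_distrib)
    finally show ?thesis using k(1) by (simp add: field_simps power2_eq_square power3_eq_cube)
  qed
  have "nrm H (B *v y) = (1 / k) * nrm H y" for y
  proof (cases "nrm H y = 0")
    case False
    then obtain x where "y = shp F x" by (rule shp_surj)
    then show ?thesis by (simp only: *)
  next
    case True
    show ?thesis
    proof (rule ccontr)
      \<comment> \<open>If N'(B y) were nonzero, then B y = (A x)# for some x, hence y = k x# and
        N(x) = 0; this contradicts N'((A x)#) = k^2 N(x)^2.\<close>
      assume "nrm H (B *v y) \<noteq> 1 / k * nrm H y"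
      then have nz: "nrm H (B *v y) \<noteq> 0" using True by simp
      then obtain w where w: "B *v y = shp F w" by (rule shp_surj)
      obtain x where x: "w = A *v x" using contragredient_surj[OF assms(2)] .
      have "B *v y = B *v (k *s shp F x)"
        unfolding w x by (simp add: A.similitude_shp[OF assms] vec.scale)
      then have "y = k *s shp F x"
        by (rule contragredient_inj[OF assms(2)])
      then have "nrm F x = 0" using True k(1) by (simp add: B.nrm_scale nrm_shp)
      then show False using nz unfolding w x nrm_shp k(2) by simp
    qed
  qed
  then show ?thesis using k(1) by (simp add: similitude_def)
qed

text \<open>In the second term of U, the factor k from # and the factor 1/k from the cross product
  on the dual cancel.\<close>

lemma uop_similitude:
  assumes "similitude F A k" "contragredient A B"
  shows "uop F H (A *v a) (B *v y) = A *v uop F H a y"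
proof -
  have B: "similitude H B (1 / k)" "contragredient B A" and "k \<noteq> 0"
    using similitude_contragredient[OF assms] assms by (auto simp: contragredient_commute similitude_def)
  have "crs H (shp F (A *v a)) (B *v y) = A *v crs H (shp F a) y"
    using \<open>k \<noteq> 0\<close> by (simp add: A.similitude_shp[OF assms] B.crs_linear B.similitude_crs[OF B]
        vector_smult_assoc)
  then show ?thesis
    using assms(2) by (simp add: uop_def contragredient_def vec.scale matrix_vector_mult_diff_distrib)
qed

end

section \<open>Polynomial functions\<close>

lemma polynomial_functions_const: "(\<lambda>_. c) \<in> polynomial_functions"
  unfolding polynomial_functions_def by (rule generated_algebra.const)

lemma polynomial_functions_coord: "(\<lambda>x. x $ i) \<in> polynomial_functions"
  unfolding polynomial_functions_def by (rule generated_algebra.gen) simp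

lemma polynomial_functions_mult:
  "p \<in> polynomial_functions \<Longrightarrow> q \<in> polynomial_functions \<Longrightarrow> (\<lambda>x. p x * q x) \<in> polynomial_functions"
  unfolding polynomial_functions_def by (rule generated_algebra.mult)

lemma generated_algebra_sum:
  assumes "\<And>i. i \<in> I \<Longrightarrow> p i \<in> generated_algebra S"
  shows "(\<lambda>x. \<Sum>i\<in>I. p i x) \<in> generated_algebra S"
  using assms
  by (induction I rule: infinite_finite_induct)
    (simp_all add: generated_algebra.const generated_algebra.add)

lemma generated_algebra_prod:
  assumes "\<And>i. i \<in> I \<Longrightarrow> p i \<in> generated_algebra S"
  shows "(\<lambda>x. \<Prod>i\<in>I. p i x) \<in> generated_algebra S"
  using assms
  by (induction I rule: infinite_finite_induct)
    (simp_all add: generated_algebra.const generated_algebra.mult)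

lemma generated_algebra_diff:
  assumes "p \<in> generated_algebra S" "q \<in> generated_algebra S"
  shows "(\<lambda>x. p x - q x) \<in> generated_algebra S"
  using generated_algebra.add[OF assms(1) generated_algebra.mult[OF generated_algebra.const[of "-1"] assms(2)]]
  by simp

lemmas polynomial_functions_sum = generated_algebra_sum[of _ _ "range (\<lambda>i x. x $ i)",
    folded polynomial_functions_def]

lemmas polynomial_functions_prod = generated_algebra_prod[of _ _ "range (\<lambda>i x. x $ i)",
    folded polynomial_functions_def]

lemmas polynomial_functions_diff = generated_algebra_diff[of _ "range (\<lambda>i x. x $ i)",
    folded polynomial_functions_def]

lemma polynomial_functions_compose:
  assumes "p \<in> polynomial_functions" "\<And>i. (\<lambda>a. u a $ i) \<in> generated_algebra S"
  shows "(\<lambda>a. p (u a)) \<in> generated_algebra S"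
  using assms(1) unfolding polynomial_functions_def
  by induction (auto simp: assms(2) intro: generated_algebra.intros)

lemma polynomial_function_on_line:
  assumes "p \<in> polynomial_functions"
  shows "\<exists>R. \<forall>t. p (x + t *s v) = poly R t"
  using assms unfolding polynomial_functions_def
proof induction
  case (gen s)
  then obtain i where "s = (\<lambda>x. x $ i)" by auto
  then show ?case by (intro exI[of _ "[:x $ i, v $ i:]"]) simp
next
  case (const c)
  show ?case by (intro exI[of _ "[:c:]"]) simp
next
  case (add p q)
  then show ?case by (metis poly_add)
next
  case (mult p q)
  then show ?case by (metis poly_mult)
qed

lemma polynomial_function_continuous:
  assumes "p \<in> polynomial_functions"
  shows "continuous_on UNIV p"
  using assms unfolding polynomial_functions_def
  by induction (auto intro!: continuous_intros)

lemma continuous_on_line: "continuous_on UNIV (\<lambda>t. x + t *s (v :: complex ^ 'n))"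
  unfolding vector_scalar_mult_def
  by (intro continuous_intros continuous_on_vec_lambda)

text \<open>The complex line through x0 and y meets U in infinitely many parameters, so the
  restriction of p to it is the zero polynomial.\<close>

lemma polynomial_function_zero_on_open:
  assumes "p \<in> polynomial_functions" "open U" "x0 \<in> U" "\<And>x. x \<in> U \<Longrightarrow> p x = 0"
  shows "p y = 0"
proof -
  from polynomial_function_on_line[OF assms(1), of x0 "y - x0"]
  obtain R where R: "\<forall>t. p (x0 + t *s (y - x0)) = poly R t" ..
  let ?T = "(\<lambda>t. x0 + t *s (y - x0)) -` U"
  have "open ?T"
    by (rule open_vimage[OF assms(2) continuous_on_line])
  moreover have "0 \<in> ?T" using assms(3) by simp
  ultimately have "infinite ?T" using finite_imp_not_open by blast
  moreover have "?T \<subseteq> {t. poly R t = 0}"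
    using assms(4) by (intro subsetI CollectI) (simp only: R[rule_format, symmetric] vimage_eq)
  ultimately have "R = 0" using poly_roots_finite finite_subset by blast
  then show ?thesis using R[rule_format, of 1] by simp
qed

lemma polynomial_function_mult_zero:
  assumes "p \<in> polynomial_functions" "q \<in> polynomial_functions" "q x0 \<noteq> 0" "\<And>x. q x * p x = 0"
  shows "p y = 0"
proof (rule polynomial_function_zero_on_open[OF assms(1)])
  have "continuous_on UNIV q" using assms(2) by (rule polynomial_function_continuous)
  then show "open (q -` (- {0}))" using continuous_on_open_vimage[of UNIV q] by auto
qed (use assms in auto)

section \<open>Homogeneous cubic polynomial functions as symmetric trilinear forms\<close>

definition is_linear_form :: "(complex ^ 'n \<Rightarrow> complex) \<Rightarrow> bool" where
  "is_linear_form l \<longleftrightarrow> (\<forall>x y. l (x + y) = l x + l y) \<and> (\<forall>c x. l (c *s x) = c * l x)"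

lemma is_linear_form_intros:
  "is_linear_form (\<lambda>_. 0)"
  "is_linear_form l \<Longrightarrow> is_linear_form m \<Longrightarrow> is_linear_form (\<lambda>x. l x + m x)"
  "is_linear_form l \<Longrightarrow> is_linear_form (\<lambda>x. c * l x)"
  "is_linear_form l \<Longrightarrow> is_linear_form (\<lambda>x. l x * c)"
  by (auto simp: is_linear_form_def algebra_simps)

text \<open>Carries the parts of degree at most three through an induction on the generation of p.
  \<open>R x\<close> is the polynomial t -> p (t x); its higher coefficients are left free, and
  \<open>B\<close> and \<open>T\<close> need not be symmetric.\<close>

definition homogeneous_parts where
  "homogeneous_parts p R c L B T \<longleftrightarrow> (\<forall>x t. p (t *s x) = poly (R x) t) \<and>
    (\<forall>x. poly.coeff (R x) 0 = c \<and> poly.coeff (R x) 1 = L x \<and> poly.coeff (R x) 2 = B x x \<and>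
      poly.coeff (R x) 3 = T x x x) \<and>
    is_linear_form L \<and> (\<forall>x. is_linear_form (B x) \<and> is_linear_form (\<lambda>y. B y x)) \<and>
    (\<forall>x y. is_linear_form (T x y) \<and> is_linear_form (\<lambda>z. T x z y) \<and> is_linear_form (\<lambda>z. T z x y))"

lemma polynomial_function_homogeneous_parts:
  assumes "p \<in> polynomial_functions"
  shows "\<exists>R c L B T. homogeneous_parts p R c L B T"
  using assms unfolding polynomial_functions_def
proof induction
  case (gen s)
  then obtain i where s: "s = (\<lambda>x. x $ i)" by auto
  have "homogeneous_parts s (\<lambda>x. [:0, x $ i:]) 0 (\<lambda>x. x $ i) (\<lambda>_ _. 0) (\<lambda>_ _ _. 0)"
    unfolding homogeneous_parts_def s
    by (simp add: is_linear_form_intros coeff_pCons eval_nat_numeral)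
      (simp add: is_linear_form_def)
  then show ?case by blast
next
  case (const c)
  have "homogeneous_parts (\<lambda>_. c) (\<lambda>x. [:c:]) c (\<lambda>x. 0) (\<lambda>_ _. 0) (\<lambda>_ _ _. 0)"
    unfolding homogeneous_parts_def
    by (simp add: is_linear_form_intros coeff_pCons eval_nat_numeral)
  then show ?case by blast
next
  case (add p q)
  then obtain R c L B T R' c' L' B' T' where
    p: "homogeneous_parts p R c L B T" and q: "homogeneous_parts q R' c' L' B' T'"
    by blast
  have "homogeneous_parts (\<lambda>x. p x + q x) (\<lambda>x. R x + R' x) (c + c') (\<lambda>x. L x + L' x)
      (\<lambda>x y. B x y + B' x y) (\<lambda>x y z. T x y z + T' x y z)"
    using p q unfolding homogeneous_parts_def by (simp add: is_linear_form_intros)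
  then show ?case by blast
next
  case (mult p q)
  then obtain R c L B T R' c' L' B' T' where
    p: "homogeneous_parts p R c L B T" and q: "homogeneous_parts q R' c' L' B' T'"
    by blast
  have co: "poly.coeff (R x * R' x) 0 = c * c'"
    "poly.coeff (R x * R' x) 1 = c * L' x + L x * c'"
    "poly.coeff (R x * R' x) 2 = c * B' x x + L x * L' x + B x x * c'"
    "poly.coeff (R x * R' x) 3 = c * T' x x x + L x * B' x x + B x x * L' x + T x x x * c'" for x
    using p q unfolding homogeneous_parts_def by (simp_all add: coeff_mult eval_nat_numeral)
  have "homogeneous_parts (\<lambda>x. p x * q x) (\<lambda>x. R x * R' x) (c * c') (\<lambda>x. c * L' x + L x * c')
      (\<lambda>x y. c * B' x y + L x * L' y + B x y * c')
      (\<lambda>x y z. c * T' x y z + L x * B' y z + B x y * L' z + T x y z * c')"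
    using p q unfolding homogeneous_parts_def co by (simp add: is_linear_form_intros)
  then show ?case by blast
qed

lemma homogeneous_cubic_form:
  assumes "f \<in> polynomial_functions" "homogeneous_function 3 f"
  obtains F where "cubic_form F" "f = nrm F"
proof -
  obtain R c L B T where R: "\<And>x t. f (t *s x) = poly (R x) t" and
    co: "\<And>x. poly.coeff (R x) 3 = T x x x" and
    T: "\<And>x y. is_linear_form (T x y)" "\<And>x y. is_linear_form (\<lambda>z. T x z y)"
      "\<And>x y. is_linear_form (\<lambda>z. T z x y)"
    using polynomial_function_homogeneous_parts[OF assms(1)] unfolding homogeneous_parts_def by blast
  have f: "f x = T x x x" for x
  proof -
    \<comment> \<open>The extra factor t covers t = 0, about which homogeneity says nothing.\<close>
    have "poly ([:0, 1:] * (R x - Polynomial.monom (f x) 3)) t = 0" for t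
    proof (cases "t = 0")
      case False
      then have "f (t *s x) = t ^ 3 * f x"
        using assms(2) by (simp add: homogeneous_function_def power_int_def)
      then show ?thesis by (simp add: R poly_monom)
    qed simp
    then have "[:0, 1:] * (R x - Polynomial.monom (f x) 3) = 0" using poly_all_0_iff_0 by blast
    then have "R x = Polynomial.monom (f x) 3" by simp
    then show ?thesis using co[of x] by simp
  qed
  \<comment> \<open>The sum over all six orders, without division: F x x x = 6 T x x x, which the
    1/6 in \<open>nrm\<close> compensates.\<close>
  define F where "F = (\<lambda>x y z. T x y z + T x z y + T y x z + T y z x + T z x y + T z y x)"
  have "cubic_form F"
    using T by unfold_locales (auto simp: F_def is_linear_form_def algebra_simps)
  moreover have "f = nrm F" by (simp add: fun_eq_iff f nrm_def F_def)
  ultimately show ?thesis by (rule that)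
qed

lemma axis_eq_scale: "axis i t = t *s axis i (1 :: complex)"
  by (simp add: Finite_Cartesian_Product.vec_eq_iff axis_def)

lemma scaleR_eq_scale: "r *\<^sub>R x = complex_of_real r *s x"
  by (simp add: Finite_Cartesian_Product.vec_eq_iff scaleR_conv_of_real[where 'a = complex])

text \<open>The derivative of the map at x is h -> b x h + b h x. In finite dimension injectivity
  makes it invertible, so Sussmann's open mapping theorem applies. Serves both for # and for the
  orbit map.\<close>

lemma quadratic_map_open_at:
  fixes b :: "'a :: euclidean_space \<Rightarrow> 'a \<Rightarrow> 'a"
  assumes b: "bilinear b" "\<And>h. b x h + b h x = 0 \<Longrightarrow> h = 0" and "open T" "x \<in> T"
  shows "b x x \<in> interior ((\<lambda>x. b x x) ` T)"
proof -
  let ?L = "\<lambda>h. b x h + b h x"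
  interpret bb: bounded_bilinear b using b(1) by (simp add: bilinear_conv_bounded_bilinear)
  have lin: "linear ?L"
    by (intro linear_compose_add) (use b(1) in \<open>auto simp: bilinear_def\<close>)
  then have "inj ?L" using b(2) linear_injective_0 by blast
  then obtain g where g: "linear g" "?L \<circ> g = id"
    using lin linear_injective_imp_surjective linear_surjective_right_inverse by blast
  show ?thesis
  proof (rule sussmann_open_mapping[of UNIV "\<lambda>x. b x x" x ?L g T])
    show "continuous_on UNIV (\<lambda>x. b x x)"
      by (intro bb.continuous_on continuous_intros)
    show "((\<lambda>x. b x x) has_derivative ?L) (at x)"
      by (intro bb.FDERIV has_derivative_ident)
    show "bounded_linear g" using g(1) by (simp add: linear_conv_bounded_linear)
  qed (use g assms in \<open>auto simp: interior_open\<close>)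
qed

section \<open>Polynomiality and derivatives of N, # and the cross product\<close>

context cubic_form begin

lemma expand: "F x y z = (\<Sum>i\<in>UNIV. \<Sum>j\<in>UNIV. \<Sum>k\<in>UNIV.
    x $ i * (y $ j * (z $ k * F (axis i 1) (axis j 1) (axis k 1))))"
proof -
  have 1: "F x y z = (\<Sum>i\<in>UNIV. x $ i * F (axis i 1) y z)"
    using functional_eq_pr[of "\<lambda>x. F x y z" x] by (simp add: add1 scale1 pr_def)
  have 2: "F u y z = (\<Sum>i\<in>UNIV. y $ i * F u (axis i 1) z)" for u
    using functional_eq_pr[of "\<lambda>y. F u y z" y] by (simp add: add2 scale2 pr_def)
  have 3: "F u v z = (\<Sum>i\<in>UNIV. z $ i * F u v (axis i 1))" for u v
    using functional_eq_pr[of "\<lambda>z. F u v z" z] by (simp add: add3 scale3 pr_def)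
  have 23: "F u y z = (\<Sum>j\<in>UNIV. \<Sum>k\<in>UNIV. y $ j * (z $ k * F u (axis j 1) (axis k 1)))" for u
    by (subst 2, subst 3) (simp only: sum_distrib_left)
  show ?thesis
    by (subst 1, subst 23) (simp only: sum_distrib_left)
qed

lemma polynomial_functions_form:
  assumes "\<And>i. (\<lambda>a. u a $ i) \<in> polynomial_functions"
    "\<And>i. (\<lambda>a. v a $ i) \<in> polynomial_functions" "\<And>i. (\<lambda>a. w a $ i) \<in> polynomial_functions"
  shows "(\<lambda>a. F (u a) (v a) (w a)) \<in> polynomial_functions"
  by (subst expand)
    (intro polynomial_functions_sum polynomial_functions_mult polynomial_functions_const assms)

lemma polynomial_functions_crs:
  assumes "\<And>i. (\<lambda>a. u a $ i) \<in> polynomial_functions" "\<And>i. (\<lambda>a. v a $ i) \<in> polynomial_functions"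
  shows "(\<lambda>a. crs F (u a) (v a) $ i) \<in> polynomial_functions"
  unfolding crs_def by (simp, intro polynomial_functions_form assms polynomial_functions_const)

lemma polynomial_functions_shp:
  assumes "\<And>i. (\<lambda>a. u a $ i) \<in> polynomial_functions"
  shows "(\<lambda>a. shp F (u a) $ i) \<in> polynomial_functions"
  using polynomial_functions_mult[OF polynomial_functions_const[of "1 / 2"]
      polynomial_functions_crs[OF assms assms, of i]]
  by (simp add: shp_def)

lemma polynomial_functions_nrm:
  assumes "\<And>i. (\<lambda>a. u a $ i) \<in> polynomial_functions"
  shows "(\<lambda>a. nrm F (u a)) \<in> polynomial_functions"
  using polynomial_functions_mult[OF polynomial_functions_form[OF assms assms assms]
      polynomial_functions_const[of "1 / 6"]]
  by (simp add: nrm_def)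

lemma nrm_line:
  "nrm F (x + t *s z) = nrm F x + t * pr z (shp F x) + t\<^sup>2 * pr x (shp F z) + t ^ 3 * nrm F z"
  by (simp add: nrm_add nrm_scale shp_scale pr_linear)

lemma shp_line: "shp F (x + t *s z) = shp F x + (t *s crs F x z + t\<^sup>2 *s shp F z)"
  by (simp add: shp_add shp_scale crs_linear)

lemma nrm_has_derivative:
  "((\<lambda>t. nrm F (x + axis i t)) has_field_derivative shp F x $ i) (at 0)"
proof -
  have eq: "nrm F (x + axis i t) = nrm F x + t * shp F x $ i + t\<^sup>2 * pr x (shp F (axis i 1))
      + t ^ 3 * nrm F (axis i 1)" for t
    unfolding axis_eq_scale[of i t] nrm_line by simp
  show ?thesis unfolding eq by (auto intro!: derivative_eq_intros)
qed

lemma shp_has_derivative: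
  "((\<lambda>t. shp F (x + axis i t) $ j) has_field_derivative crs F x (axis i 1) $ j) (at 0)"
proof -
  have eq: "shp F (x + axis i t) $ j = shp F x $ j + t * crs F x (axis i 1) $ j
      + t\<^sup>2 * shp F (axis i 1) $ j" for t
    unfolding axis_eq_scale[of i t] shp_line by simp
  show ?thesis unfolding eq by (auto intro!: derivative_eq_intros)
qed

lemma partial_nrm: "partial i (nrm F) x = shp F x $ i"
  unfolding partial_def using nrm_has_derivative by (rule DERIV_imp_deriv)

lemma differential_nrm: "differential (nrm F) x = shp F x"
  by (simp add: differential_def partial_nrm)

lemma hessian_log_nrm:
  assumes "nrm F x \<noteq> 0"
  shows "hessian_log (nrm F) x $ i $ j =
    (crs F x (axis i 1) $ j * nrm F x - shp F x $ j * shp F x $ i) / (nrm F x)\<^sup>2"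
proof -
  have ax: "x + axis i 0 = x" by (simp add: axis_eq_0_iff)
  have "nrm F \<in> polynomial_functions"
    using polynomial_functions_nrm[of "\<lambda>x. x"] polynomial_functions_coord by blast
  then have "hessian_log (nrm F) x $ i $ j = partial i (\<lambda>y. shp F y $ j / nrm F y) x"
    using assms by (simp add: hessian_log_polynomial_function partial_nrm)
  also have "\<dots> = (crs F x (axis i 1) $ j * nrm F x - shp F x $ j * shp F x $ i) / (nrm F x)\<^sup>2"
    unfolding partial_def
  proof (rule DERIV_imp_deriv)
    show "((\<lambda>t. shp F (x + axis i t) $ j / nrm F (x + axis i t)) has_field_derivative
      (crs F x (axis i 1) $ j * nrm F x - shp F x $ j * shp F x $ i) / (nrm F x)\<^sup>2) (at 0)"
      using DERIV_divide[OF shp_has_derivative[of x i j] nrm_has_derivative[of x i]] assms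
      by (simp add: ax power2_eq_square)
  qed
  finally show ?thesis .
qed

text \<open>If x \<times> v = 0, then <v, x#> = <x, x \<times> v> / 2 = 0, so both terms of
  \<open>hessian_log_nrm\<close> annihilate v and v lies in the kernel of an invertible
  matrix.\<close>

lemma nondegenerate_log_hessian_crs:
  assumes "nondegenerate_log_hessian (nrm F)"
  obtains x where "\<And>v. crs F x v = 0 \<Longrightarrow> v = 0"
proof -
  obtain x where x: "nrm F x \<noteq> 0" "Determinants.det (hessian_log (nrm F) x) \<noteq> 0"
    using assms by (auto simp: nondegenerate_log_hessian_def)
  have "v = 0" if v: "crs F x v = 0" for v
  proof -
    have 1: "pr v (shp F x) = 0"
      using pr_crs_same[of x v] v by simp
    have 2: "pr v (crs F x (axis i 1)) = 0" for i
      using pr_crs_rotate[of v x "axis i 1"] v by simp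
    have "(hessian_log (nrm F) x *v v) $ i =
        (pr v (crs F x (axis i 1)) * nrm F x - pr v (shp F x) * shp F x $ i) / (nrm F x)\<^sup>2" for i
    proof -
      have "(hessian_log (nrm F) x *v v) $ i = (\<Sum>j\<in>UNIV. v $ j * crs F x (axis i 1) $ j *
          (nrm F x / (nrm F x)\<^sup>2) - v $ j * shp F x $ j * (shp F x $ i / (nrm F x)\<^sup>2))"
        by (simp add: matrix_vector_mult_def hessian_log_nrm[OF x(1)] algebra_simps diff_divide_distrib)
      then show ?thesis
        by (simp only: sum_subtractf sum_distrib_right[symmetric] pr_def diff_divide_distrib) simp
    qed
    then have "hessian_log (nrm F) x *v v = 0"
      by (simp add: Finite_Cartesian_Product.vec_eq_iff 1 2)
    moreover have "\<exists>B. B ** hessian_log (nrm F) x = Finite_Cartesian_Product.mat 1"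
      using x(2) invertible_det_nz invertible_def by blast
    ultimately show ?thesis by (simp only: matrix_left_invertible_ker)
  qed
  then show ?thesis by (rule that)
qed

lemma bilinear_crs: "bilinear (crs F)"
  by (auto simp: bilinear_def crs_linear scaleR_eq_scale intro!: linearI)

lemma crs_axis_matrix: "(\<chi> i j. crs F x (axis j 1) $ i) *v v = crs F x v"
proof -
  have "((\<chi> i j. crs F x (axis j 1) $ i) *v v) $ i = F x v (axis i 1)" for i
  proof -
    have "F x v (axis i 1) = (\<Sum>j\<in>UNIV. v $ j * F x (axis j 1) (axis i 1))"
      using functional_eq_pr[of "\<lambda>v. F x v (axis i 1)" v] by (simp add: add2 scale2 pr_def)
    then show ?thesis by (simp add: matrix_vector_mult_def crs_def mult.commute)
  qed
  then show ?thesis by (simp add: Finite_Cartesian_Product.vec_eq_iff crs_def)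
qed

end

section \<open>From the Legendre transform to the adjoint identity\<close>

lemma sextic_linear_coeff:
  fixes a0 a1 a2 a3 a4 b0 b1 b2 b3 b4 :: complex
  assumes "\<And>t. a0 + t * a1 + t\<^sup>2 * a2 + t ^ 3 * a3 + t ^ 4 * a4 + t ^ 5 * a5 + t ^ 6 * a6 =
    b0 + t * b1 + t\<^sup>2 * b2 + t ^ 3 * b3 + t ^ 4 * b4 + t ^ 5 * b5 + t ^ 6 * b6"
  shows "a1 = b1"
proof -
  have "poly [:a0 - b0, a1 - b1, a2 - b2, a3 - b3, a4 - b4, a5 - b5, a6 - b6:] t = 0" for t
    using assms[of t] by (simp add: algebra_simps eval_nat_numeral)
  then have "[:a0 - b0, a1 - b1, a2 - b2, a3 - b3, a4 - b4, a5 - b5, a6 - b6:] = 0"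
    using poly_all_0_iff_0 by blast
  then show "a1 = b1" by simp
qed

text \<open>Differentiating the norm identity in direction z gives <z, x \<times> x##> = 2 N(x) <z,
  x#>. As 2 x# = x \<times> x, the defect x## - N(x) x is killed by x \<times> _ .\<close>

lemma sharp_sharp_of_norm_sharp:
  assumes "cubic_form F" "cubic_form H" and nrm: "\<And>x. nrm H (shp F x) = (nrm F x)\<^sup>2"
    and inj: "\<And>v. crs F x0 v = 0 \<Longrightarrow> v = 0"
  shows "shp H (shp F x) = nrm F x *s x"
proof -
  interpret A: cubic_form F by fact
  interpret B: cubic_form H by fact
  define w where "w = (\<lambda>x. shp H (shp F x) - nrm F x *s x)"
  have w: "crs F x (w x) = 0" for x
  proof (rule pr_eqI)
    fix z
    let ?A = "shp F x" and ?C = "crs F x z" and ?D = "shp F z"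
    have "nrm H ?A + t * pr ?C (shp H ?A) + t\<^sup>2 * (pr ?D (shp H ?A) + pr ?A (shp H ?C))
        + t ^ 3 * (pr ?A (crs H ?C ?D) + nrm H ?C) + t ^ 4 * (pr ?A (shp H ?D) + pr ?D (shp H ?C))
        + t ^ 5 * pr ?C (shp H ?D) + t ^ 6 * nrm H ?D =
        (nrm F x)\<^sup>2 + t * (2 * nrm F x * pr z ?A)
        + t\<^sup>2 * ((pr z ?A)\<^sup>2 + 2 * nrm F x * pr x ?D)
        + t ^ 3 * (2 * nrm F x * nrm F z + 2 * pr z ?A * pr x ?D)
        + t ^ 4 * ((pr x ?D)\<^sup>2 + 2 * pr z ?A * nrm F z)
        + t ^ 5 * (2 * pr x ?D * nrm F z) + t ^ 6 * (nrm F z)\<^sup>2" for t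
    proof -
      have "nrm H (shp F (x + t *s z)) = (nrm F (x + t *s z))\<^sup>2" by (rule nrm)
      then show ?thesis
        unfolding A.shp_line A.nrm_line B.nrm_add B.shp_add B.nrm_scale B.shp_scale B.crs_linear pr_linear
        by (simp add: algebra_simps eval_nat_numeral)
    qed
    then have "pr ?C (shp H ?A) = 2 * nrm F x * pr z ?A" by (rule sextic_linear_coeff)
    moreover have "pr z (crs F x (shp H ?A)) = pr ?C (shp H ?A)"
      using A.pr_crs_rotate[of z x "shp H ?A"] by (simp only: pr_commute[of ?C])
    ultimately show "pr z (crs F x (w x)) = pr z 0"
      by (simp add: w_def A.crs_linear A.crs_self pr_linear)
  qed
  have pw: "(\<lambda>x. w x $ i) \<in> polynomial_functions" for i
    unfolding w_def vector_minus_component vector_smult_component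
    by (intro polynomial_functions_diff polynomial_functions_mult A.polynomial_functions_nrm
        A.polynomial_functions_shp B.polynomial_functions_shp polynomial_functions_coord)
  define M where "M = (\<lambda>x. \<chi> i j. crs F x (axis j 1) $ i)"
  \<comment> \<open>The Hessian determinant of N. Where it is nonzero the defect vanishes, so its
    product with each coordinate of \<open>w\<close> is identically zero.\<close>
  define q where "q = (\<lambda>x. Determinants.det (M x))"
  have pq: "q \<in> polynomial_functions"
    unfolding q_def Determinants.det_def M_def vec_lambda_beta
    by (intro polynomial_functions_sum polynomial_functions_mult polynomial_functions_const
        polynomial_functions_prod A.polynomial_functions_crs polynomial_functions_coord)
  have ker: "q x \<noteq> 0 \<longleftrightarrow> (\<forall>v. crs F x v = 0 \<longrightarrow> v = 0)" for x
    unfolding q_def invertible_det_nz[symmetric] invertible_left_inverse matrix_left_invertible_ker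
    unfolding M_def A.crs_axis_matrix ..
  have "w x $ i = 0" for x i
  proof (rule polynomial_function_mult_zero[OF pw pq, of x0])
    show "q x0 \<noteq> 0" using inj ker by blast
    show "q y * w y $ i = 0" for y
      using ker[of y] w[of y] by auto
  qed
  then show ?thesis by (simp add: w_def Finite_Cartesian_Product.vec_eq_iff)
qed

text \<open>At y = x# the second identity follows from the first: y## = (N(x) x)# = N(x)^2 y. The
  image of # has interior points because # is open at x0, and both sides are polynomial.\<close>

lemma adjoint_pair_of_norm_sharp:
  assumes "cubic_form F" "cubic_form H" and nrm: "\<And>x. nrm H (shp F x) = (nrm F x)\<^sup>2"
    and inj: "\<And>v. crs F x0 v = 0 \<Longrightarrow> v = 0"
  shows "adjoint_pair F H"
proof -
  interpret A: cubic_form F by fact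
  interpret B: cubic_form H by fact
  have adj: "shp H (shp F x) = nrm F x *s x" for x
    using sharp_sharp_of_norm_sharp[OF assms] .
  have "crs F x0 x0 \<in> interior ((\<lambda>x. crs F x x) ` UNIV)"
  proof (rule quadratic_map_open_at[OF A.bilinear_crs])
    show "h = 0" if "crs F x0 h + crs F h x0 = 0" for h
    proof (rule inj)
      have "crs F x0 h $ i + crs F x0 h $ i = 0" for i
        using that by (metis A.crs_commute vector_add_component zero_index)
      then show "crs F x0 h = 0" by (simp add: Finite_Cartesian_Product.vec_eq_iff)
    qed
  qed simp_all
  \<comment> \<open>The open mapping lemma speaks of x \<times> x = 2 x#; rescaling x by a root of 2
    makes it a value of #.\<close>
  moreover have "crs F x x = shp F (csqrt 2 *s x)" for x
    by (simp only: A.shp_scale power2_csqrt A.crs_self)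
  then have "range (\<lambda>x. crs F x x) \<subseteq> range (shp F)" by auto
  ultimately have int: "crs F x0 x0 \<in> interior (range (shp F))"
    using interior_mono by blast
  have "(shp F (shp H y) - nrm H y *s y) $ i = 0" for y i
  proof (rule polynomial_function_zero_on_open[OF _ open_interior int,
        of "\<lambda>y. (shp F (shp H y) - nrm H y *s y) $ i"])
    show "(\<lambda>y. (shp F (shp H y) - nrm H y *s y) $ i) \<in> polynomial_functions"
      unfolding vector_minus_component vector_smult_component
      by (intro polynomial_functions_diff polynomial_functions_mult B.polynomial_functions_nrm
        A.polynomial_functions_shp B.polynomial_functions_shp polynomial_functions_coord)
    show "(shp F (shp H y) - nrm H y *s y) $ i = 0" if y: "y \<in> interior (range (shp F))" for y
    proof -
      obtain x where "y = shp F x" using y interior_subset by blast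
      then show ?thesis by (simp add: adj A.shp_scale nrm)
    qed
  qed
  then have "shp F (shp H y) = nrm H y *s y" for y
    by (simp add: Finite_Cartesian_Product.vec_eq_iff)
  with adj show ?thesis by unfold_locales
qed

text \<open>Passing from x to t x divides the argument of g by t and its value by t^3.\<close>

lemma legendre_transform_degree:
  assumes "cubic_form F" "homogeneous_function d g" "open U" "x \<in> U"
    and g: "\<And>x. x \<in> U \<Longrightarrow> nrm F x \<noteq> 0 \<and> g (inverse (nrm F x) *s shp F x) = 1 / nrm F x"
  shows "d = 3"
proof -
  interpret A: cubic_form F by fact
  have hom: "c \<noteq> 0 \<Longrightarrow> g (c *s y) = c powi d * g y" for c y
    using assms(2) by (simp add: homogeneous_function_def)
  let ?T = "(\<lambda>t. 0 + t *s x) -` U"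
  have "open ?T" by (rule open_vimage[OF assms(3) continuous_on_line])
  moreover have "1 \<in> ?T" using assms(4) by simp
  ultimately obtain e where e: "e > 0" "ball 1 e \<subseteq> ?T" using open_contains_ball by blast
  \<comment> \<open>A real t > 1 close to 1: t x stays in U, and integer powers of r > 1 are
    strictly monotone in the exponent.\<close>
  define r where "r = 1 + e / 2"
  define t where "t = complex_of_real r"
  have r: "r > 1" using e by (simp add: r_def)
  have "dist 1 t = e / 2" using e unfolding t_def r_def dist_norm
    by (simp add: norm_divide)
  then have "t \<in> ball 1 e" using e(1) by simp
  then have "t \<in> ?T" using e(2) by blast
  then have "t *s x \<in> U" by simp
  from g[OF this] have 1: "g (inverse (t ^ 3 * nrm F x) *s (t\<^sup>2 *s shp F x)) = 1 / (t ^ 3 * nrm F x)"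
    by (simp only: A.nrm_scale A.shp_scale)
  have 2: "inverse (t ^ 3 * nrm F x) *s (t\<^sup>2 *s shp F x) =
      inverse t *s (inverse (nrm F x) *s shp F x)"
    using r by (simp add: vector_smult_assoc t_def field_simps power2_eq_square power3_eq_cube)
  have 3: "g (inverse t *s (inverse (nrm F x) *s shp F x)) =
      inverse t powi d * g (inverse (nrm F x) *s shp F x)"
    by (rule hom) (use r in \<open>simp add: t_def\<close>)
  have "inverse t powi d * (1 / nrm F x) = 1 / (t ^ 3 * nrm F x)"
    using 1 g[OF assms(4)] unfolding 2 3 by metis
  then have "inverse t powi d = inverse t powi 3"
    using g[OF assms(4)] r by (simp add: field_simps t_def power_int_def)
  then have "t powi d = t powi 3" by (simp only: power_int_inverse inverse_eq_iff_eq)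
  then have "complex_of_real (r powi d) = complex_of_real (r powi 3)" by (simp add: t_def)
  then have "r powi d = r powi 3" by (simp only: of_real_eq_iff)
  then show ?thesis using r by (smt (verit) power_int_strict_increasing)
qed

text \<open>Once the transform is known to be cubic, N'(x# / N(x)) = 1 / N(x) becomes N'(x#) =
  N(x)^2 on U, hence everywhere.\<close>

lemma EKP_homaloidal_cubic_adjoint_pair:
  assumes "EKP_homaloidal f" "homogeneous_function 3 f"
  obtains F H where "adjoint_pair F H" "f = nrm F"
proof -
  have f: "f \<in> polynomial_functions" "nondegenerate_log_hessian f"
    using assms(1) by (auto simp: EKP_homaloidal_def)
  obtain g where g: "g \<in> polynomial_functions" "is_multiplicative_legendre_transform f g"
    using assms(1) by (auto simp: EKP_homaloidal_def)
  obtain F where F: "cubic_form F" "f = nrm F"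
    using homogeneous_cubic_form[OF f(1) assms(2)] .
  interpret A: cubic_form F by fact
  obtain d where d: "homogeneous_function d g"
    using g(2) by (auto simp: is_multiplicative_legendre_transform_def)
  obtain U x where U: "open U" "x \<in> U" and
    gU: "\<And>x. x \<in> U \<Longrightarrow> nrm F x \<noteq> 0 \<and> g (inverse (nrm F x) *s shp F x) = 1 / nrm F x"
    using g(2) unfolding is_multiplicative_legendre_transform_def F(2) A.differential_nrm by blast
  have "d = 3" using legendre_transform_degree[OF F(1) d U gU] .
  then obtain H where H: "cubic_form H" "g = nrm H"
    using homogeneous_cubic_form[OF g(1)] d by metis
  interpret B: cubic_form H by fact
  have "nrm H (shp F y) - (nrm F y)\<^sup>2 = 0" for y
  proof (rule polynomial_function_zero_on_open[OF _ U, of "\<lambda>y. nrm H (shp F y) - (nrm F y)\<^sup>2"])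
    show "(\<lambda>y. nrm H (shp F y) - (nrm F y)\<^sup>2) \<in> polynomial_functions"
      unfolding power2_eq_square
      by (intro polynomial_functions_diff polynomial_functions_mult B.polynomial_functions_nrm
          A.polynomial_functions_nrm A.polynomial_functions_shp polynomial_functions_coord)
    show "nrm H (shp F y) - (nrm F y)\<^sup>2 = 0" if "y \<in> U" for y
      using gU[OF that] unfolding H(2) B.nrm_scale
      by (auto simp: field_simps power2_eq_square power3_eq_cube)
  qed
  then have nrm: "nrm H (shp F y) = (nrm F y)\<^sup>2" for y by simp
  obtain x0 where "\<And>v. crs F x0 v = 0 \<Longrightarrow> v = 0"
    using A.nondegenerate_log_hessian_crs f(2) F(2) by blast
  then have "adjoint_pair F H" using adjoint_pair_of_norm_sharp[OF F(1) H(1) nrm] by blast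
  then show ?thesis using F(2) by (rule that)
qed

section \<open>Isolated points and orthogonal splittings\<close>

context adjoint_pair begin

lemma uop_line:
  "uop F H (a + t *s d) y = uop F H a y +
    t *s (pr d y *s a + pr a y *s d - crs H (crs F a d) y) + t\<^sup>2 *s uop F H d y"
  by (simp add: uop_def A.shp_line B.crs_linear pr_linear Finite_Cartesian_Product.vec_eq_iff
      algebra_simps power2_eq_square)

text \<open>U is quadratic along a line, so its third difference with step t vanishes. Combined with
  \<open>nrm_avoid_zeros\<close>, this expresses any U_a by U at three points of nonzero
  norm.\<close>

lemma uop_interpolation:
  "uop F H a y = 3 *s uop F H (a + t *s d) y - 3 *s uop F H (a + (2 * t) *s d) y
    + uop F H (a + (3 * t) *s d) y"
  unfolding uop_line
  by (simp add: Finite_Cartesian_Product.vec_eq_iff algebra_simps power2_eq_square)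

lemma nrm_avoid_zeros:
  assumes "nrm F d \<noteq> 0"
  obtains t where "nrm F (a + t *s d) \<noteq> 0" "nrm F (a + (2 * t) *s d) \<noteq> 0"
    "nrm F (a + (3 * t) *s d) \<noteq> 0"
proof -
  define R where "R = [:nrm F a, pr d (shp F a), pr a (shp F d), nrm F d:]"
  have R: "nrm F (a + t *s d) = poly R t" for t
    by (simp add: R_def A.nrm_line algebra_simps power2_eq_square power3_eq_cube)
  define Z where "Z = {t. poly R t = 0}"
  have "R \<noteq> 0" using assms by (simp add: R_def)
  then have "finite Z" unfolding Z_def by (rule poly_roots_finite)
  \<comment> \<open>Halves and thirds of the zeros are excluded too, so that 2 t and 3 t also avoid
    Z.\<close>
  then have "finite (Z \<union> (\<lambda>s. s / 2) ` Z \<union> (\<lambda>s. s / 3) ` Z)" by simp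
  from ex_new_if_finite[OF infinite_UNIV_char_0 this]
  obtain t where t: "t \<notin> Z \<union> (\<lambda>s. s / 2) ` Z \<union> (\<lambda>s. s / 3) ` Z" ..
  have "2 * t \<notin> Z"
  proof
    assume "2 * t \<in> Z"
    then have "(2 * t) / 2 \<in> (\<lambda>s. s / 2) ` Z" by (rule imageI)
    then show False using t by simp
  qed
  moreover have "3 * t \<notin> Z"
  proof
    assume "3 * t \<in> Z"
    then have "(3 * t) / 3 \<in> (\<lambda>s. s / 3) ` Z" by (rule imageI)
    then show False using t by simp
  qed
  ultimately show ?thesis using t by (intro that[of t]) (auto simp: R Z_def)
qed

text \<open>For Jordan algebras this says that \<open>e\<^sup>2 = 1\<close> has only \<open>e = 1\<close> as solution of trace 3, and only
  finitely many traces occur.\<close>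

lemma uop_eq_isolated:
  assumes c: "nrm F c = 1" and eq: "\<And>y. uop F H e y = uop F H c y"
  shows "pr e (shp F c) = 3 \<Longrightarrow> e = c"
    and "pr e (shp F c) = 3 \<or> (pr e (shp F c) + 3) * ((pr e (shp F c))\<^sup>2 - 1) = 0"
proof -
  let ?\<tau> = "pr e (shp F c)" and ?\<epsilon> = "nrm F e"
  have c0: "c \<noteq> 0" using c by auto
  have Uc: "uop F H c (shp F c) = c" by (simp add: uop_shp_self c)
  have "nrm F (uop F H e (shp F c)) = ?\<epsilon>\<^sup>2 * nrm H (shp F c)" by (rule nrm_uop_shp)
  then have \<epsilon>: "?\<epsilon>\<^sup>2 = 1" by (simp add: eq Uc c nrm_shp)
  \<comment> \<open>Two evaluations of c# \<times> e#, from U_c e# = U_e e# = N(e) e and from U_e c#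
    = U_c c# = c, combine to a linear relation between e and c.\<close>
  have 1: "crs H (shp F c) (shp F e) = pr c (shp F e) *s c - ?\<epsilon> *s e"
    using uop_shp_self[of e, unfolded eq] by (simp add: uop_def algebra_simps)
  have 2: "crs H (shp F e) (shp F c) = ?\<tau> *s e - c"
    using Uc[folded eq] by (simp add: uop_def algebra_simps)
  have 3: "(?\<tau> + ?\<epsilon>) *s e = (pr c (shp F e) + 1) *s c"
  proof -
    have "?\<tau> *s e - c = pr c (shp F e) *s c - ?\<epsilon> *s e"
      using 1 2 B.crs_commute[of "shp F c" "shp F e"] by simp
    then show ?thesis by (simp add: Finite_Cartesian_Product.vec_eq_iff algebra_simps)
  qed
  have "?\<tau>\<^sup>2 = 1 \<or> (e = c \<and> ?\<tau> = 3) \<or> (?\<tau> = -3)"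
  \<comment> \<open>If the coefficient of e vanishes, the trace is a sign. Otherwise e = l c, where
    l^2 = 1 and the trace is 3 l.\<close>
  proof (cases "?\<tau> + ?\<epsilon> = 0")
    case True
    then have "?\<tau> = - ?\<epsilon>" by (simp add: eq_neg_iff_add_eq_0)
    then show ?thesis using \<epsilon> by simp
  next
    case False
    define l where "l = (pr c (shp F e) + 1) / (?\<tau> + ?\<epsilon>)"
    have "e = (1 / (?\<tau> + ?\<epsilon>)) *s ((?\<tau> + ?\<epsilon>) *s e)"
      using False by (simp only: vector_smult_assoc) simp
    then have e: "e = l *s c" unfolding 3 by (simp only: l_def vector_smult_assoc mult.commute[of "1 / _"] times_divide_eq_right mult_1_right)
    have "l\<^sup>2 *s c = c"
      using eq[of "shp F c"] uop_scale_base[of l c "shp F c"] by (simp add: e Uc)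
    then have "(l\<^sup>2 - 1) *s c = 0" by (simp add: vector_sub_rdistrib)
    then have "l\<^sup>2 - 1 = 0" using c0 by (simp only: vector_mul_eq_0) simp
    then have "l = 1 \<or> l = -1" by (simp add: power2_eq_1_iff)
    moreover have "?\<tau> = 3 * l" by (simp add: e pr_linear A.pr_shp c)
    ultimately show ?thesis using e by auto
  qed
  then show "?\<tau> = 3 \<Longrightarrow> e = c" "?\<tau> = 3 \<or> (?\<tau> + 3) * (?\<tau>\<^sup>2 - 1) = 0" by auto
qed

text \<open>The hypothesis says <u \<times> v, b#> = <u, b> <v, b> for all b; polarize in b.\<close>

lemma uop_orthogonal_crs:
  assumes "\<And>b. pr v (uop H F b u) = 0"
  shows "crs H b (crs F u v) = pr u b *s v + pr v b *s u"
proof (rule pr_eqI)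
  fix z
  have *: "pr (crs F u v) (shp H b) = pr u b * pr v b" for b
  proof -
    have "pr (crs F u v) (shp H b) = pr v (crs F (shp H b) u)"
      using A.pr_crs_rotate[of "shp H b" u v] A.crs_commute[of u "shp H b"]
      by (simp only: pr_commute[of "crs F u v"])
    then show ?thesis
      using assms[of b] by (simp add: uop_def pr_linear pr_commute[of b])
  qed
  have "pr z (crs H b (crs F u v)) = pr (crs F u v) (crs H b z)"
    by (rule B.pr_crs_rotate)
  also have "crs H b z = shp H (b + z) - shp H b - shp H z" by (simp add: B.shp_add)
  also have "pr (crs F u v) \<dots> = pr z (pr u b *s v + pr v b *s u)"
    by (simp add: pr_linear *) (simp add: pr_commute[of z] algebra_simps)
  finally show "pr z (crs H b (crs F u v)) = pr z (pr u b *s v + pr v b *s u)" .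
qed

text \<open>For v = u the preceding lemma gives b \<times> u# = <u, b> u. Taking b = u# and
  comparing with \<open>adj\<close> gives N(u) = 0; taking b = u \<times> x and comparing with
  \<open>adj1\<close> gives u# = 0. Then <u, b> u = 0 for all b.\<close>

lemma no_absolute_zero_divisor:
  assumes "\<And>b. pr u (uop H F b u) = 0"
  shows "u = 0"
proof (rule ccontr)
  assume u: "u \<noteq> 0"
  have *: "crs H b (shp F u) = pr u b *s u" for b
    using uop_orthogonal_crs[OF assms, of b]
    by (simp add: A.crs_self B.crs_linear Finite_Cartesian_Product.vec_eq_iff)
  have "2 *s (nrm F u *s u) = (3 * nrm F u) *s u"
    using *[of "shp F u"] by (simp add: B.crs_self adj A.pr_shp)
  then have N: "nrm F u = 0"
    using u by (auto simp: Finite_Cartesian_Product.vec_eq_iff)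
  have "pr x (shp F u) = 0" for x
  proof -
    have "pr x (shp F u) *s u = (2 * pr x (shp F u)) *s u"
      using *[of "crs F u x"] adj1[of u x] N A.pr_crs_same[of u x]
      by (simp add: B.crs_commute[of "crs F u x"])
    then show ?thesis using u by (auto simp: Finite_Cartesian_Product.vec_eq_iff)
  qed
  then have "shp F u = 0" by (intro pr_eqI) simp
  then have "pr u b *s u = 0" for b using *[of b] by (simp add: B.crs_linear)
  then have "pr b u = 0" for b using u pr_commute by (metis vector_mul_eq_0)
  then have "u = 0" by (intro pr_eqI) simp
  with u show False ..
qed

text \<open>W' turns out to be a line spanned by some v0, and the factors come from N(w + m v0) = m
  <v0, w#>. Their vanishing at 0 records that neither is a unit.\<close>

lemma factor_of_orthogonal_splitting_aux:
  assumes orth: "\<And>u v b. u \<in> W \<Longrightarrow> v \<in> W' \<Longrightarrow> pr v (uop H F b u) = 0"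
    and W': "vec.subspace W'"
    and split: "\<And>x. \<exists>w\<in>W. \<exists>v\<in>W'. x = w + v"
    and nW: "\<And>w. w \<in> W \<Longrightarrow> nrm F w = 0" and nW': "W' \<noteq> {0}"
    and sq: "\<And>v. v \<in> W' \<Longrightarrow> shp F v = 0"
    and c: "nrm F c \<noteq> 0"
  shows "\<exists>p q. p \<in> polynomial_functions \<and> q \<in> polynomial_functions \<and> p 0 = 0 \<and> q 0 = 0 \<and>
    nrm F = (\<lambda>x. p x * q x)"
proof -
  interpret D: adjoint_pair H F by (rule dual)
  let ?T = "\<lambda>x y. pr x (uop H F (shp F c) y)" and ?l = "\<lambda>v. pr v (shp F c)"
  have T: "?T v v2 = ?l v * ?l v2" if "v \<in> W'" "v2 \<in> W'" for v v2
  proof -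
    have "shp F (v + v2) = 0" using that W' by (intro sq) (rule vec.subspace_add)
    then have 0: "crs F v v2 = 0" using that by (simp add: A.shp_add sq)
    have "pr v (crs F (shp H (shp F c)) v2) = pr (shp H (shp F c)) (crs F v v2)"
      by (simp only: A.crs_commute[of _ v2] A.pr_crs_rotate[of v v2])
    then show ?thesis by (simp add: uop_def pr_linear 0 pr_commute[of "shp F c"])
  qed
  \<comment> \<open>On W' the form \<open>?T\<close> is the product of two values of
    \<open>?l\<close>, and W is orthogonal to W'; so a zero of \<open>?l\<close> in W' lies in the
    radical of \<open>?T\<close>, which is trivial since U_{c#} is injective.\<close>
  have nondeg: "v = 0" if v: "v \<in> W'" "?l v = 0" for v
  proof -
    have "pr x (uop H F (shp F c) v) = 0" for x
    proof -
      obtain w v2 where x: "x = w + v2" "w \<in> W" "v2 \<in> W'" using split by blast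
      have "pr w (uop H F (shp F c) v) = 0"
        using orth[OF x(2) v(1)] by (simp only: D.uop_symmetric[of v])
      then show ?thesis using T[OF x(3) v(1)] v(2) by (simp add: x(1) pr_linear)
    qed
    then have "uop H F (shp F c) v = 0" by (intro pr_eqI) simp
    then have "(nrm F c)\<^sup>2 *s v = 0" using uop_uop_shp[of c v] by (simp add: uop_zero)
    then show ?thesis using c by simp
  qed
  obtain v0 where v0: "v0 \<in> W'" "v0 \<noteq> 0"
    using nW' vec.subspace_0[OF W'] by blast
  then have l0: "?l v0 \<noteq> 0" using nondeg by blast
  \<comment> \<open>The coordinate of x along v0: the orthogonal projection for \<open>?T\<close>,
    normalized by T(v0, v0) = l(v0)^2.\<close>
  define m where "m = (\<lambda>x. ?T x v0 * (1 / (?l v0)\<^sup>2))"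
  define q where "q = (\<lambda>x. pr v0 (shp F (x - m x *s v0)))"
  have "nrm F x = m x * q x" for x
  proof -
    obtain w v where x: "x = w + v" "w \<in> W" "v \<in> W'" using split by blast
    have "?T w v0 = 0"
      using orth[OF x(2) v0(1)] by (simp only: D.uop_symmetric[of v0])
    then have mx: "m x = ?l v / ?l v0"
      using T[OF x(3) v0(1)] l0 by (simp add: m_def x(1) pr_linear power2_eq_square)
    have "v - m x *s v0 = 0"
    proof (rule nondeg)
      show "v - m x *s v0 \<in> W'"
        using x(3) v0(1) W' by (intro vec.subspace_diff vec.subspace_scale)
      show "?l (v - m x *s v0) = 0" using l0 by (simp add: pr_linear mx)
    qed
    then have v: "v = m x *s v0" by simp
    then have w: "w = x - m x *s v0" using x(1) by simp
    have "nrm F v = 0" using A.pr_shp[of v] sq[OF x(3)] by simp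
    then have "nrm F x = pr v (shp F w)" by (simp add: x(1) A.nrm_add nW[OF x(2)] sq[OF x(3)])
    also have "\<dots> = m x * q x" unfolding q_def w[symmetric] by (simp add: v pr_linear)
    finally show ?thesis .
  qed
  moreover have "m \<in> polynomial_functions"
    unfolding m_def pr_def
    by (intro polynomial_functions_mult polynomial_functions_sum polynomial_functions_coord
        polynomial_functions_const)
  moreover from this have "q \<in> polynomial_functions"
    unfolding q_def pr_def
    by (intro polynomial_functions_mult polynomial_functions_sum
        polynomial_functions_const A.polynomial_functions_shp)
      (simp, intro polynomial_functions_diff polynomial_functions_mult polynomial_functions_coord
        polynomial_functions_const)
  moreover have "m 0 = 0" "q 0 = 0" by (simp_all add: m_def q_def)
  ultimately show ?thesis by blast
qed

text \<open>It remains to see that N vanishes on both summands and # on one of them; the preceding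
  lemma then applies, possibly with the summands exchanged.\<close>

lemma factor_of_orthogonal_splitting:
  assumes orth: "\<And>u v b. u \<in> W \<Longrightarrow> v \<in> W' \<Longrightarrow> pr v (uop H F b u) = 0"
    and W: "vec.subspace W" "W \<noteq> {0}" and W': "vec.subspace W'" "W' \<noteq> {0}"
    and split: "\<And>x. \<exists>w\<in>W. \<exists>v\<in>W'. x = w + v"
    and c: "nrm F c \<noteq> 0"
  shows "\<exists>p q. p \<in> polynomial_functions \<and> q \<in> polynomial_functions \<and> p 0 = 0 \<and> q 0 = 0 \<and>
    nrm F = (\<lambda>x. p x * q x)"
proof -
  interpret D: adjoint_pair H F by (rule dual)
  have nrm0: "nrm F w = 0"
    if orth: "\<And>u v b. u \<in> W \<Longrightarrow> v \<in> W' \<Longrightarrow> pr v (uop H F b u) = 0"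
      and W': "vec.subspace W'" "W' \<noteq> {0}" and w: "w \<in> W" for W W' w
  proof -
    obtain v where v: "v \<in> W'" "v \<noteq> 0" using W' vec.subspace_0 by blast
    \<comment> \<open>Two values of w# \<times> (w \<times> v): \<open>adj1\<close> has N(w) v where
      orthogonality has <w, w#> v = 3 N(w) v.\<close>
    have "nrm F w *s v + pr v (shp F w) *s w = (3 * nrm F w) *s v + pr v (shp F w) *s w"
      using uop_orthogonal_crs[OF orth[OF w v(1)], of "shp F w"]
      by (simp add: adj1 A.pr_shp)
    then show ?thesis using v(2) by (auto simp: Finite_Cartesian_Product.vec_eq_iff)
  qed
  have orth': "pr u (uop H F b v) = 0" if "v \<in> W'" "u \<in> W" for u v b
    using orth[OF that(2,1)] by (simp only: D.uop_symmetric[of v])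
  have nW: "\<And>w. w \<in> W \<Longrightarrow> nrm F w = 0" by (rule nrm0[of W W'], rule orth, assumption+) (use W' in blast)+
  have nW': "\<And>v. v \<in> W' \<Longrightarrow> nrm F v = 0" by (rule nrm0[of W' W], rule orth', assumption+) (use W in blast)+
  have pr0: "pr w2 (shp F w1) = 0"
    if "\<forall>w\<in>W. nrm F w = 0" "vec.subspace W" "w1 \<in> W" "w2 \<in> W" for W w1 w2
  proof -
    \<comment> \<open>The two signs separate the mixed terms <w2, w1#> and <w1, w2#>.\<close>
    have "nrm F (w1 + w2) = 0" "nrm F (w1 + (-1) *s w2) = 0"
      using that(2-4) by (blast intro: that(1)[rule_format] vec.subspace_add vec.subspace_scale)+
    then show ?thesis using that unfolding A.nrm_line by (simp add: A.nrm_add)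
  qed
  have prod0: "crs H (shp F w) (shp F v) = 0" if "w \<in> W" "v \<in> W'" for w v
  proof -
    \<comment> \<open>Orthogonality at b = w \<times> v computes (w \<times> v)# as the whole right
      side of \<open>adj2\<close>, so nothing is left for w# \<times> v#.\<close>
    have "2 *s shp H (crs F w v) = (2 * pr v (shp F w)) *s v + (2 * pr w (shp F v)) *s w"
      using uop_orthogonal_crs[OF orth[OF that], of "crs F w v"] A.pr_crs_same[of w v] A.pr_crs_same[of v w]
      by (simp add: B.crs_self A.crs_commute[of v w])
    then have "2 *s shp H (crs F w v) = 2 *s (pr v (shp F w) *s v + pr w (shp F v) *s w)"
      by (simp only: vector_add_ldistrib vector_smult_assoc)
    then have "shp H (crs F w v) = pr v (shp F w) *s v + pr w (shp F v) *s w"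
      by (simp only: vector_mul_lcancel) simp
    then show ?thesis using adj2[of w v] by simp
  qed
  have "(\<forall>w\<in>W. shp F w = 0) \<or> (\<forall>v\<in>W'. shp F v = 0)"
  proof (rule ccontr)
    assume "\<not> ?thesis"
    then obtain w1 v1 where 1: "w1 \<in> W" "shp F w1 \<noteq> 0" "v1 \<in> W'" "shp F v1 \<noteq> 0" by blast
    obtain x where "pr x (shp F w1) \<noteq> 0" using 1(2) pr_eqI[of "shp F w1" 0] by auto
    moreover obtain w' v where "x = w' + v" "w' \<in> W" and v: "v \<in> W'" using split by blast
    ultimately have nv: "pr v (shp F w1) \<noteq> 0" using pr0[OF ballI[OF nW] W(1) 1(1)] by (simp add: pr_linear)
    obtain z where "pr z (shp F v1) \<noteq> 0" using 1(4) pr_eqI[of "shp F v1" 0] by auto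
    moreover obtain w v' where "z = w + v'" and w: "w \<in> W" and "v' \<in> W'" using split by blast
    ultimately have nw: "pr w (shp F v1) \<noteq> 0" using pr0[OF ballI[OF nW'] W'(1) 1(3)] by (simp add: pr_linear)
    \<comment> \<open>This pairing vanishes since w1# \<times> v1# = 0, but by orthogonality at b =
      w1# it equals the nonzero product <v, w1#> <w, v1#>.\<close>
    have "pr (shp F v1) (crs H (shp F w1) (crs F w v)) = pr (crs F w v) (crs H (shp F w1) (shp F v1))"
      by (rule B.pr_crs_rotate)
    then have "pr (shp F v1) (pr v (shp F w1) *s w) = 0"
      using uop_orthogonal_crs[OF orth[OF w v], of "shp F w1"] pr0[OF ballI[OF nW] W(1) 1(1) w]
      by (simp add: prod0[OF 1(1,3)])
    then show False using nv nw by (simp add: pr_linear pr_commute[of "shp F v1"])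
  qed
  then show ?thesis
  proof
    assume "\<forall>v\<in>W'. shp F v = 0"
    then show ?thesis
      by (intro factor_of_orthogonal_splitting_aux[of W W' c] orth W' split nW c) auto
  next
    assume 0: "\<forall>w\<in>W. shp F w = 0"
    have "\<exists>v\<in>W'. \<exists>w\<in>W. x = v + w" for x using split[of x] add.commute by metis
    with 0 show ?thesis
      by (intro factor_of_orthogonal_splitting_aux[of W' W c] orth' W nW' c) auto
  qed
qed

end

section \<open>Similitudes\<close>

lemma matrix_of_linear:
  fixes f :: "complex ^ 'n \<Rightarrow> complex ^ 'n"
  assumes "\<And>x y. f (x + y) = f x + f y" "\<And>k x. f (k *s x) = k *s f x"
  shows "matrix f *v x = f x"
  by (rule matrix_works)
    (simp add: Vector_Spaces.linear_iff vec.vector_space_axioms assms)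

lemma contragredient_unique:
  assumes "contragredient A B" "contragredient A B'"
  shows "B = B'"
proof -
  have "B *v y = B' *v y" for y
  proof (rule pr_eqI)
    fix z
    obtain x where "z = A *v x" using contragredient_surj[OF assms(1)] .
    then show "pr z (B *v y) = pr z (B' *v y)" using assms by (simp add: contragredient_def)
  qed
  then show ?thesis by (simp add: matrix_eq)
qed

lemma contragredient_exists:
  assumes "invertible A"
  shows "\<exists>B. contragredient A B"
proof -
  from assms obtain A' where "A' ** A = Finite_Cartesian_Product.mat 1"
    unfolding invertible_def by blast
  then have "contragredient A (Finite_Cartesian_Product.transpose A')"
    by (simp add: contragredient_iff matrix_transpose_mul[symmetric])
  then show ?thesis ..
qed

lemma contragredient_mult:
  "contragredient A B \<Longrightarrow> contragredient A' B' \<Longrightarrow> contragredient (A ** A') (B ** B')"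
  by (simp add: contragredient_def matrix_vector_mul_assoc[symmetric])

definition contra :: "complex ^ 'n ^ 'n \<Rightarrow> complex ^ 'n ^ 'n" where
  "contra A = (SOME B. contragredient A B)"

lemma contra: "invertible A \<Longrightarrow> contragredient A (contra A)"
  unfolding contra_def by (rule someI_ex) (rule contragredient_exists)

lemma contra_eqI: "contragredient A B \<Longrightarrow> contra A = B"
  unfolding contra_def by (rule some_equality) (auto intro: contragredient_unique)

lemma similitude_mult:
  "similitude F A k \<Longrightarrow> similitude F B l \<Longrightarrow> similitude F (A ** B) (k * l)"
  by (simp add: similitude_def matrix_vector_mul_assoc[symmetric])

lemma similitude_inverse:
  assumes "similitude F A k" "A ** B = Finite_Cartesian_Product.mat 1"
  shows "similitude F B (1 / k)"
proof -
  have k: "k \<noteq> 0" and *: "nrm F (A *v (B *v x)) = k * nrm F (B *v x)" for x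
    using assms(1) by (simp_all add: similitude_def)
  have "A *v (B *v x) = x" for x by (simp add: matrix_vector_mul_assoc assms(2))
  then have "nrm F (B *v x) = 1 / k * nrm F x" for x using *[of x] k by (simp add: field_simps)
  then show ?thesis using k by (simp add: similitude_def)
qed

context adjoint_pair begin

text \<open>The source of group elements: a single U maps the dual to the space, while a product of
  two acts on V.\<close>

lemma similitude_uop_uop:
  assumes "nrm F a \<noteq> 0" "nrm H b \<noteq> 0" "k \<noteq> 0"
  obtains A l where "similitude F A l" "\<And>x. A *v x = k *s uop F H a (uop H F b x)"
proof -
  interpret D: adjoint_pair H F by (rule dual)
  let ?f = "\<lambda>x. k *s uop F H a (uop H F b x)"
  have f: "matrix ?f *v x = ?f x" for x
    by (rule matrix_of_linear)
      (simp_all only: uop_add uop_scale D.uop_add D.uop_scale vector_add_ldistrib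
        vector_smult_assoc mult.commute)
  have "similitude F (matrix ?f) (k ^ 3 * ((nrm F a)\<^sup>2 * (nrm H b)\<^sup>2))"
    using assms unfolding similitude_def f by (simp add: A.nrm_scale nrm_uop D.nrm_uop)
  then show ?thesis using f by (rule that)
qed

text \<open>A vector v killed by A satisfies x \<times> v = 0 for all x. Then \<open>adj1\<close>
  puts v on the line of c, and the cross product with c gives <v, c#> = 0.\<close>

lemma similitude_invertible:
  assumes "similitude F A k" "nrm F c \<noteq> 0"
  shows "invertible A"
proof -
  have "v = 0" if "A *v v = 0" for v
  proof -
    have k: "k \<noteq> 0" using assms(1) by (simp add: similitude_def)
    have "F x y v = 0" for x y
    proof -
      have "F (A *v x) (A *v y) (A *v v) = 0"
        unfolding that using A.scale3[of _ _ 0 0] by simp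
      then show ?thesis using A.similitude_trilinear[OF assms(1)] k by simp
    qed
    then have 0: "crs F x v = 0" for x
      by (intro pr_eqI) (simp add: A.pr_crs A.swap23[of _ _ v] A.swap12[of _ v] A.swap23[of v])
    have 1: "nrm F c *s v + pr v (shp F c) *s c = 0"
      using adj1[of c v] by (simp add: 0 B.crs_linear)
    have "pr v (shp F c) *s (2 *s shp F c) = crs F c (nrm F c *s v + pr v (shp F c) *s c)"
      by (simp only: A.crs_linear A.crs_self 0) simp
    then have "pr v (shp F c) = 0 \<or> shp F c = 0" unfolding 1 by (auto simp: A.crs_linear)
    moreover have "shp F c \<noteq> 0" using assms(2) A.pr_shp[of c] by auto
    ultimately show "v = 0" using 1 assms(2) by simp
  qed
  then have "\<exists>B. B ** A = Finite_Cartesian_Product.mat 1" by (simp add: matrix_left_invertible_ker)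
  then show ?thesis by (simp add: invertible_left_inverse)
qed

text \<open>\<open>b\<close> polarizes a -> 2 U_a x#, and \<open>adj1\<close> gives b x h = 2 N(x)
  h, so that a -> b a a is open at x.\<close>

lemma similitude_orbit_neighbourhood:
  assumes N: "nrm F x \<noteq> 0"
  obtains S where "open S" "x \<in> S" "\<And>y. y \<in> S \<Longrightarrow> \<exists>A k. similitude F A k \<and> A *v x = y"
proof -
  let ?N = "nrm F x" and ?d = "shp F x"
  define b where "b = (\<lambda>a a'. pr a ?d *s a' + pr a' ?d *s a - crs H (crs F a a') ?d)"
  have comm: "b a a' = b a' a" for a a'
    by (simp add: b_def A.crs_commute[of a])
  have lin: "b (a + a') a'' = b a a'' + b a' a''" "b (r *s a) a'' = r *s b a a''" for a a' a'' r
    by (simp_all add: b_def pr_linear A.crs_linear B.crs_linear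
        Finite_Cartesian_Product.vec_eq_iff algebra_simps)
  have bil: "bilinear b"
    unfolding bilinear_def
  proof (intro conjI allI linearI)
    show "b y (a + a') = b y a + b y a'" for y a a'
      using lin(1)[of a a' y] by (simp only: comm[of y])
    show "b y (r *\<^sub>R a) = r *\<^sub>R b y a" for y r a
      using lin(2)[of "of_real r" a y] by (simp only: comm[of y] scaleR_eq_scale)
  qed (simp_all only: lin scaleR_eq_scale)
  have diag: "b a a = 2 *s uop F H a ?d" for a
    by (simp add: b_def uop_def A.crs_self B.crs_linear Finite_Cartesian_Product.vec_eq_iff algebra_simps)
  have bx: "b x h = (2 * ?N) *s h" for h
    using adj1[of x h] B.crs_commute[of ?d "crs F x h"]
    by (simp add: b_def A.pr_shp Finite_Cartesian_Product.vec_eq_iff algebra_simps)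
  let ?T = "{a. nrm F a \<noteq> 0}"
  have "nrm F \<in> polynomial_functions"
    using A.polynomial_functions_nrm[of "\<lambda>x. x"] polynomial_functions_coord by blast
  then have "continuous_on UNIV (nrm F)" by (rule polynomial_function_continuous)
  then have "open ?T"
    using continuous_on_open_vimage[of UNIV "nrm F"] by (auto simp: vimage_def Compl_eq)
  have "b x x \<in> interior ((\<lambda>a. b a a) ` ?T)"
  proof (rule quadratic_map_open_at[OF bil _ \<open>open ?T\<close>])
    show "h = 0" if "b x h + b h x = 0" for h
    proof -
      have "(4 * ?N) *s h = b x h + b h x"
        unfolding comm[of h] bx by (simp add: Finite_Cartesian_Product.vec_eq_iff)
      then show ?thesis using that N by simp
    qed
  qed (use N in simp)
  then have int: "(2 * ?N) *s x \<in> interior ((\<lambda>a. b a a) ` ?T)" by (simp only: bx)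
  show ?thesis
  proof (rule that)
    let ?S = "(\<lambda>z. (2 * ?N) *s z) -` interior ((\<lambda>a. b a a) ` ?T)"
    have "continuous_on UNIV (\<lambda>z. (2 * ?N) *s z)"
      unfolding vector_scalar_mult_def by (intro continuous_intros continuous_on_vec_lambda)
    then show "open ?S" by (rule open_vimage[OF open_interior])
    show "x \<in> ?S" using int by simp
    show "\<exists>A k. similitude F A k \<and> A *v x = y" if "y \<in> ?S" for y
    proof -
      have "(2 * ?N) *s y \<in> interior ((\<lambda>a. b a a) ` ?T)" using that by (rule vimageD)
      then have "(2 * ?N) *s y \<in> (\<lambda>a. b a a) ` ?T" by (rule subsetD[OF interior_subset])
      then obtain a where a: "nrm F a \<noteq> 0" "(2 * ?N) *s y = b a a" by blast
      have nz: "nrm H ?d \<noteq> 0" "1 / ?N\<^sup>2 \<noteq> 0" using N by (simp_all add: nrm_shp)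
      \<comment> \<open>As U_{x#} x = N(x) x#, this scaling makes A x = U_a x# / N(x), which is y by
        the choice of a.\<close>
      obtain A l where A: "similitude F A l" "\<And>z. A *v z = (1 / ?N\<^sup>2) *s uop F H a (uop H F ?d z)"
        using similitude_uop_uop[OF a(1) nz] by blast
      have "uop H F ?d x = ?N *s ?d"
        unfolding uop_adj by (simp add: A.pr_shp A.crs_self Finite_Cartesian_Product.vec_eq_iff)
      then have "A *v x = (1 / ?N\<^sup>2 * ?N / 2) *s (2 *s uop F H a ?d)"
        by (simp add: A(2) uop_scale vector_smult_assoc)
      also have "\<dots> = (1 / ?N\<^sup>2 * ?N / 2) *s ((2 * ?N) *s y)" by (simp only: a(2) diag)
      also have "\<dots> = y" using N by (simp add: vector_smult_assoc power2_eq_square)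
      finally show ?thesis using A(1) by blast
    qed
  qed
qed

text \<open>One complex line through a and b is enough: without the finitely many zeros of N it
  stays connected, and lying in the same orbit is a locally constant equivalence relation on
  it.\<close>

lemma similitude_transitive:
  assumes "nrm F a \<noteq> 0" "nrm F b \<noteq> 0"
  shows "\<exists>A k. similitude F A k \<and> A *v a = b"
proof -
  define g where "g = (\<lambda>t. a + t *s (b - a))"
  define R where "R = [:nrm F a, pr (b - a) (shp F a), pr a (shp F (b - a)), nrm F (b - a):]"
  have R: "nrm F (g t) = poly R t" for t
    unfolding g_def A.nrm_line
    by (simp add: R_def algebra_simps power2_eq_square power3_eq_cube)
  have g01: "g 0 = a" "g 1 = b" by (simp_all add: g_def)
  have "R \<noteq> 0" using R[of 0] g01(1) assms(1) by auto
  then have "finite {t. poly R t = 0}" by (rule poly_roots_finite)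
  then have conn: "connected (UNIV - {t. poly R t = 0})"
    by (intro connected_open_delete_finite) (simp_all add: convex_connected)
  define rel where "rel = (\<lambda>s t. \<exists>A k. similitude F A k \<and> A *v g s = g t)"
  have "rel 0 1"
  proof (rule connected_equivalence_relation[OF conn])
    show "0 \<in> UNIV - {t. poly R t = 0}" "1 \<in> UNIV - {t. poly R t = 0}"
      using assms by (simp_all add: R[symmetric] g01)
  next
    fix s t assume "rel s t"
    then obtain A k where A: "similitude F A k" "A *v g s = g t" unfolding rel_def by blast
    obtain B where B: "A ** B = Finite_Cartesian_Product.mat 1" "B ** A = Finite_Cartesian_Product.mat 1"
      using similitude_invertible[OF A(1) assms(1)] unfolding invertible_def by blast
    have "B *v g t = g s" unfolding A(2)[symmetric] by (simp add: matrix_vector_mul_assoc B(2))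
    then show "rel t s" unfolding rel_def using similitude_inverse[OF A(1) B(1)] by blast
  next
    fix r s t assume "rel r s" "rel s t"
    then obtain A k B l where A: "similitude F A k" "A *v g r = g s"
      and B: "similitude F B l" "B *v g s = g t" unfolding rel_def by blast
    have "(B ** A) *v g r = g t" by (simp add: matrix_vector_mul_assoc[symmetric] A(2) B(2))
    then show "rel r t" unfolding rel_def using similitude_mult[OF B(1) A(1)] by blast
  next
    fix s assume "s \<in> UNIV - {t. poly R t = 0}"
    then have "nrm F (g s) \<noteq> 0" by (simp add: R)
    then obtain S where S: "open S" "g s \<in> S"
      "\<And>y. y \<in> S \<Longrightarrow> \<exists>A k. similitude F A k \<and> A *v g s = y"
      by (rule similitude_orbit_neighbourhood) blast
    let ?T = "(UNIV - {t. poly R t = 0}) \<inter> g -` S"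
    have "open (g -` S)" unfolding g_def by (rule open_vimage[OF S(1) continuous_on_line])
    then have "openin (top_of_set (UNIV - {t. poly R t = 0})) ?T" by (rule openin_open_Int)
    moreover have "s \<in> ?T" using S(2) \<open>s \<in> _\<close> by simp
    moreover have "\<forall>t\<in>?T. rel s t" using S(3) unfolding rel_def by simp
    ultimately show "\<exists>T. openin (top_of_set (UNIV - {t. poly R t = 0})) T \<and> s \<in> T \<and> (\<forall>t\<in>T. rel s t)"
      by blast
  qed
  then show ?thesis unfolding rel_def g01 .
qed

end

section \<open>The involution attached to a base point, and invariant subspaces\<close>

locale based_adjoint_pair = adjoint_pair F H for F H +
  fixes c :: "complex ^ 'n"
  assumes nrm_base: "nrm F c = 1"
begin

sublocale D: adjoint_pair H F by (rule dual)

definition uc :: "complex ^ 'n ^ 'n" where "uc = matrix (uop F H c)"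
definition uc' :: "complex ^ 'n ^ 'n" where "uc' = matrix (uop H F (shp F c))"

lemma uc: "uc *v y = uop F H c y"
  unfolding uc_def by (rule matrix_of_linear) (simp_all add: uop_add uop_scale)

lemma uc': "uc' *v x = uop H F (shp F c) x"
  unfolding uc'_def by (rule matrix_of_linear) (simp_all add: D.uop_add D.uop_scale)

lemma uc_uc': "uc ** uc' = Finite_Cartesian_Product.mat 1"
  by (simp add: matrix_eq matrix_vector_mul_assoc[symmetric] uc uc' uop_uop_shp nrm_base)

lemma uc'_uc: "uc' ** uc = Finite_Cartesian_Product.mat 1"
  by (simp add: matrix_eq matrix_vector_mul_assoc[symmetric] uc uc' uop_uop_shp' nrm_base)

lemma contragredient_uc: "contragredient uc uc'"
  unfolding contragredient_def
proof (intro allI)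
  fix x y
  have "pr (uc *v x) (uc' *v y) = pr (uc' *v y) (uop F H c x)"
    by (simp add: pr_commute uc)
  also have "\<dots> = pr x (uop F H c (uc' *v y))" by (rule uop_symmetric)
  also have "\<dots> = pr x y" by (simp add: uc' uop_uop_shp nrm_base)
  finally show "pr (uc *v x) (uc' *v y) = pr x y" .
qed

text \<open>Since N(c) = 1, \<open>uc'\<close> is the inverse of \<open>uc\<close>. The symmetry of
  U_c is what makes this conjugated inverse transpose an involution.\<close>

definition theta :: "complex ^ 'n ^ 'n \<Rightarrow> complex ^ 'n ^ 'n" where
  "theta A = uc ** contra A ** uc'"

lemma contragredient_theta:
  assumes "invertible A"
  shows "contragredient (theta A) (uc' ** A ** uc)"
  unfolding theta_def
  using contra[OF assms] contragredient_uc contragredient_commute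
  by (metis contragredient_mult)

lemma theta_mult:
  assumes "invertible A" "invertible B"
  shows "theta (A ** B) = theta A ** theta B"
proof -
  have "contra (A ** B) = contra A ** contra B"
    by (intro contra_eqI contragredient_mult contra assms)
  moreover have "theta A ** theta B = uc ** contra A ** (uc' ** uc) ** contra B ** uc'"
    by (simp only: theta_def matrix_mul_assoc)
  ultimately show ?thesis by (simp add: theta_def uc'_uc matrix_mul_assoc)
qed

lemma theta_theta:
  assumes "invertible A"
  shows "theta (theta A) = A"
proof -
  have "contra (theta A) = uc' ** A ** uc" by (rule contra_eqI[OF contragredient_theta[OF assms]])
  then have "theta (theta A) = (uc ** uc') ** A ** (uc ** uc')"
    by (simp only: theta_def[of "theta A"] matrix_mul_assoc)
  then show ?thesis by (simp add: uc_uc')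
qed

lemma similitude_theta:
  assumes "similitude F A k"
  shows "similitude F (theta A) (1 / k)"
proof -
  have "invertible A" using similitude_invertible[OF assms] nrm_base by (metis zero_neq_one)
  then have B: "similitude H (contra A) (1 / k)"
    using similitude_contragredient[OF assms] contra by blast
  have "nrm F (theta A *v x) = (1 / k) * nrm F x" for x
    using B by (simp add: theta_def matrix_vector_mul_assoc[symmetric] uc uc' nrm_uop D.nrm_uop
        nrm_shp nrm_base similitude_def)
  then show ?thesis using assms by (simp add: similitude_def)
qed

text \<open>Equivariance of U reads U_{Ac} A^{-T} = A U_c, while being fixed means U_c A^{-T} = A
  U_c; cancel A^{-T}.\<close>

lemma theta_fixed_iff:
  assumes "similitude F A k"
  shows "theta A = A \<longleftrightarrow> (\<forall>y. uop F H (A *v c) y = uop F H c y)"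
proof -
  have "invertible A" using similitude_invertible[OF assms] nrm_base by (metis zero_neq_one)
  note B = contra[OF this]
  have U: "uop F H (A *v c) (contra A *v y) = A *v uop F H c y" for y
    by (rule uop_similitude[OF assms B])
  show ?thesis
  proof
    assume fixed: "theta A = A"
    show "\<forall>y. uop F H (A *v c) y = uop F H c y"
    proof
      fix z
      obtain y where z: "z = contra A *v y"
        using contragredient_surj B contragredient_commute by metis
      have "uop F H c z = (theta A ** uc) *v y"
        by (simp add: theta_def matrix_mul_assoc[symmetric] uc'_uc)
          (simp add: matrix_vector_mul_assoc[symmetric] uc z)
      also have "\<dots> = uop F H (A *v c) z"
        unfolding fixed z U by (simp add: matrix_vector_mul_assoc[symmetric] uc)
      finally show "uop F H (A *v c) z = uop F H c z" ..
    qed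
  next
    assume eq: "\<forall>y. uop F H (A *v c) y = uop F H c y"
    have "theta A *v x = A *v x" for x
    proof -
      have "theta A *v x = uop F H (A *v c) (contra A *v (uc' *v x))"
        by (simp add: theta_def matrix_vector_mul_assoc[symmetric] uc eq)
      also have "\<dots> = A *v x" unfolding U by (simp add: uc' uop_uop_shp nrm_base)
      finally show ?thesis .
    qed
    then show "theta A = A" by (simp add: matrix_eq)
  qed
qed

text \<open>For N'(b) nonzero, U_c U_b is a similitude. Any other b is reached by interpolating
  between three points of nonzero norm on a line in direction c#.\<close>

lemma uop_uop_invariant:
  assumes W: "vec.subspace W" and inv: "\<And>A k w. similitude F A k \<Longrightarrow> w \<in> W \<Longrightarrow> A *v w \<in> W"
    and w: "w \<in> W"
  shows "uop F H c (uop H F b w) \<in> W"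
proof -
  have *: "uop F H c (uop H F b' w) \<in> W" if b': "nrm H b' \<noteq> 0" for b'
  proof -
    obtain A l where A: "similitude F A l" "\<And>x. A *v x = 1 *s uop F H c (uop H F b' x)"
      by (rule similitude_uop_uop[OF _ b', of c 1]) (auto simp: nrm_base)
    show ?thesis using inv[OF A(1) w] by (simp add: A(2))
  qed
  have "nrm H (shp F c) \<noteq> 0" by (simp add: nrm_shp nrm_base)
  then obtain t where t: "nrm H (b + t *s shp F c) \<noteq> 0" "nrm H (b + (2 * t) *s shp F c) \<noteq> 0"
    "nrm H (b + (3 * t) *s shp F c) \<noteq> 0" by (rule D.nrm_avoid_zeros)
  show ?thesis
    unfolding D.uop_interpolation[of b w t "shp F c"] uop_add uop_diff uop_scale
    using W t by (intro vec.subspace_add vec.subspace_diff vec.subspace_scale *)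
qed

text \<open>As U_c U_b preserves W, its complement W' for the form \<open>T\<close> is orthogonal to
  W for every U_b at once; a common vector is therefore an absolute zero divisor.\<close>

lemma invariant_subspace_factor:
  assumes W: "vec.subspace W" "W \<noteq> {0}" "W \<noteq> UNIV"
    and inv: "\<And>A k w. similitude F A k \<Longrightarrow> w \<in> W \<Longrightarrow> A *v w \<in> W"
  shows "\<exists>p q. p \<in> polynomial_functions \<and> q \<in> polynomial_functions \<and> p 0 = 0 \<and> q 0 = 0 \<and>
    nrm F = (\<lambda>x. p x * q x)"
proof -
  define T where "T = (\<lambda>x y. pr x (uc' *v y))"
  have T_sym: "T x y = T y x" for x y unfolding T_def uc' by (rule D.uop_symmetric)
  have T_add: "T (x + y) z = T x z + T y z" and T_scale: "T (k *s x) z = k * T x z"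
    and T_diff: "T (x - y) z = T x z - T y z" for x y z k by (simp_all add: T_def pr_linear)
  define W' where "W' = {x. \<forall>w\<in>W. T x w = 0}"
  have W': "vec.subspace W'"
    unfolding W'_def by (rule vec.subspaceI) (auto simp: T_add T_scale, simp add: T_def)
  have orth: "pr v (uop H F b u) = 0" if "u \<in> W" "v \<in> W'" for u v b
  proof -
    have "T v (uop F H c (uop H F b u)) = 0"
      using that(2) uop_uop_invariant[OF W(1) inv that(1)] by (simp add: W'_def)
    then show ?thesis
      by (simp add: T_def uc' uop_uop_shp' nrm_base)
  qed
  have disj: "u = 0" if "u \<in> W" "u \<in> W'" for u
    by (rule no_absolute_zero_divisor) (rule orth[OF that])
  have split: "\<exists>w\<in>W. \<exists>v\<in>W'. x = w + v" for x
  proof -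
    obtain B where B: "B \<subseteq> W" "vec.independent B" "W \<subseteq> vec.span B"
      by (rule vec.basis_exists[of W])
    have fin: "finite B" by (rule vec.finiteI_independent[OF B(2)])
    \<comment> \<open>L maps into W, is injective on W, and L x = 0 forces x into W'. By dimension L
      maps W onto itself, so L x = L w for some w in W, and x - w lies in W'.\<close>
    define L where "L = matrix (\<lambda>x. \<Sum>b\<in>B. T x b *s b)"
    have L: "L *v x = (\<Sum>b\<in>B. T x b *s b)" for x
      unfolding L_def
      by (rule matrix_of_linear)
        (simp_all add: T_add T_scale vector_sadd_rdistrib sum.distrib vec.scale_sum_right
          vector_smult_assoc)
    have ker: "x \<in> W'" if "L *v x = 0" for x
    proof -
      have "T x b = 0" if "b \<in> B" for b
        using vec.independentD[OF B(2) fin subset_refl _ that, of "T x"] \<open>L *v x = 0\<close>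
        unfolding L by blast
      then have "B \<subseteq> {u. T x u = 0}" by blast
      moreover have "vec.subspace {u. T x u = 0}"
        by (rule vec.subspaceI) (auto simp: T_sym[of x] T_add T_scale, simp add: T_def)
      ultimately have "vec.span B \<subseteq> {u. T x u = 0}" by (rule vec.span_minimal)
      then show ?thesis using B(3) by (auto simp: W'_def)
    qed
    have LW: "(*v) L ` UNIV \<subseteq> W"
      unfolding L using B(1) by (auto intro!: vec.subspace_sum[OF W(1)] vec.subspace_scale[OF W(1)])
    have inj: "inj_on ((*v) L) W"
      unfolding vec.inj_on_iff_eq_0[OF W(1)] using ker disj by blast
    have "(*v) L ` W = W"
    proof (rule vec.subspace_dim_equal)
      show "vec.subspace ((*v) L ` W)" by (rule vec.subspace_image[OF W(1)])
      show "vec.dim W \<le> vec.dim ((*v) L ` W)"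
        using inj vec.dim_image_eq[OF matrix_vector_mul_linear_gen[of L], of W] W(1)
        by (simp add: vec.span_eq_iff[THEN iffD2])
    qed (use W(1) LW in auto)
    then obtain w where w: "w \<in> W" "L *v x = L *v w" using LW by (metis imageE image_subset_iff UNIV_I)
    have "x - w \<in> W'" by (rule ker) (simp add: vec.diff w(2))
    then show ?thesis using w(1) by (intro bexI[of _ w] bexI[of _ "x - w"]) simp_all
  qed
  have "W' \<noteq> {0}"
  proof
    assume "W' = {0}"
    then have "x \<in> W" for x using split[of x] by auto
    then show False using W(3) by blast
  qed
  with split W' show ?thesis
    by (intro factor_of_orthogonal_splitting[of W W' c] orth W) (auto simp: nrm_base)
qed

end

section \<open>The similitude group as an algebraic group\<close>

text \<open>Translates between the matrices in \<open>GL\<close>, indexed by natural numbers, and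
  those indexed by the coordinates of V.\<close>

locale enumeration =
  fixes idx :: "'n :: finite \<Rightarrow> nat"
  assumes idx: "bij_betw idx UNIV {0..<CARD('n)}"
begin

definition rho :: "complex mat \<Rightarrow> complex ^ 'n ^ 'n" where
  "rho M = (\<chi> i j. M $$ (idx i, idx j))"

definition to_mat :: "complex ^ 'n ^ 'n \<Rightarrow> complex mat" where
  "to_mat A = Matrix.mat CARD('n) CARD('n) (\<lambda>(a, b). A $ inv_into UNIV idx a $ inv_into UNIV idx b)"

lemma idx_less: "idx i < CARD('n)"
  using idx by (auto simp: bij_betw_def)

lemma idx_inv: "a < CARD('n) \<Longrightarrow> idx (inv_into UNIV idx a) = a"
  using bij_betw_inv_into_right[OF idx, of a] by simp

lemma inv_idx: "inv_into UNIV idx (idx i) = i"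
  using bij_betw_inv_into_left[OF idx, of i] by simp

lemma idx_eq_iff: "idx i = idx j \<longleftrightarrow> i = j"
  by (metis inv_idx)

lemma to_mat_carrier: "to_mat A \<in> carrier_mat CARD('n) CARD('n)"
  by (simp add: to_mat_def)

lemma rho_to_mat: "rho (to_mat A) = A"
  by (simp add: rho_def to_mat_def idx_less inv_idx Finite_Cartesian_Product.vec_eq_iff)

lemma to_mat_rho: "M \<in> carrier_mat CARD('n) CARD('n) \<Longrightarrow> to_mat (rho M) = M"
  by (rule eq_matI) (auto simp: rho_def to_mat_def idx_inv)

lemma rho_inj:
  "M \<in> carrier_mat CARD('n) CARD('n) \<Longrightarrow> N \<in> carrier_mat CARD('n) CARD('n) \<Longrightarrow>
    rho M = rho N \<Longrightarrow> M = N"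
  by (metis to_mat_rho)

lemma rho_one: "rho (1\<^sub>m CARD('n)) = Finite_Cartesian_Product.mat 1"
  by (simp add: rho_def Finite_Cartesian_Product.vec_eq_iff Finite_Cartesian_Product.mat_def
      idx_less idx_eq_iff)

lemma rho_mult:
  assumes "M \<in> carrier_mat CARD('n) CARD('n)" "N \<in> carrier_mat CARD('n) CARD('n)"
  shows "rho (M * N) = rho M ** rho N"
proof -
  have "(M * N) $$ (idx i, idx j) = (\<Sum>k\<in>UNIV. M $$ (idx i, idx k) * N $$ (idx k, idx j))" for i j
  proof -
    have "(M * N) $$ (idx i, idx j) = (\<Sum>k\<in>{0..<CARD('n)}. M $$ (idx i, k) * N $$ (k, idx j))"
      using assms idx_less[of i] idx_less[of j] by (simp add: scalar_prod_def)
    then show ?thesis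
      using sum.reindex_bij_betw[OF idx, of "\<lambda>k. M $$ (idx i, k) * N $$ (k, idx j)"] by simp
  qed
  then show ?thesis
    by (simp add: rho_def matrix_matrix_mult_def Finite_Cartesian_Product.vec_eq_iff)
qed

lemma rho_adj_mat:
  assumes "M \<in> carrier_mat CARD('n) CARD('n)" "Determinant.det M \<noteq> 0"
  shows "rho (inverse (Determinant.det M) \<cdot>\<^sub>m adj_mat M) ** rho M = Finite_Cartesian_Product.mat 1"
proof -
  let ?X = "inverse (Determinant.det M) \<cdot>\<^sub>m adj_mat M"
  have "?X * M = inverse (Determinant.det M) \<cdot>\<^sub>m (adj_mat M * M)"
    using assms adj_mat(1)[OF assms(1)] by (simp add: mult_smult_assoc_mat)
  also have "\<dots> = 1\<^sub>m CARD('n)"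
    unfolding adj_mat(3)[OF assms(1)] using assms(2) by (intro eq_matI) auto
  finally show ?thesis
    using rho_mult[of ?X M] assms adj_mat(1)[OF assms(1)] by (simp add: rho_one)
qed

lemma rho_invertible_iff:
  assumes "M \<in> carrier_mat CARD('n) CARD('n)"
  shows "invertible (rho M) \<longleftrightarrow> Determinant.det M \<noteq> 0"
proof
  assume "invertible (rho M)"
  then obtain B where "rho M ** B = Finite_Cartesian_Product.mat 1" unfolding invertible_def by blast
  then have "rho (M * to_mat B) = rho (1\<^sub>m CARD('n))"
    by (simp add: rho_mult[OF assms to_mat_carrier] rho_to_mat rho_one)
  then have "M * to_mat B = 1\<^sub>m CARD('n)"
    by (intro rho_inj) (use assms to_mat_carrier[of B] in auto)
  then have "Determinant.det M * Determinant.det (to_mat B) = 1"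
    using det_mult[OF assms to_mat_carrier, of B] by (simp add: Determinant.det_one)
  then show "Determinant.det M \<noteq> 0" by auto
next
  assume "Determinant.det M \<noteq> 0"
  from rho_adj_mat[OF assms this] show "invertible (rho M)" by (auto simp: invertible_left_inverse)
qed

lemma contra_rho:
  assumes "M \<in> carrier_mat CARD('n) CARD('n)" "Determinant.det M \<noteq> 0"
  shows "contra (rho M) $ i $ j = inverse (Determinant.det M) * cofactor M (idx i) (idx j)"
proof -
  let ?X = "inverse (Determinant.det M) \<cdot>\<^sub>m adj_mat M"
  have "contragredient (rho M) (Finite_Cartesian_Product.transpose (rho ?X))"
    using rho_adj_mat[OF assms] by (simp add: contragredient_iff matrix_transpose_mul[symmetric])
  then have "contra (rho M) = Finite_Cartesian_Product.transpose (rho ?X)" by (rule contra_eqI)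
  then show ?thesis
    using assms(1) idx_less by (simp add: Finite_Cartesian_Product.transpose_def rho_def adj_mat_def)
qed

lemma carrier_GL_iff:
  "M \<in> carrier (GL CARD('n)) \<longleftrightarrow> M \<in> carrier_mat CARD('n) CARD('n) \<and> invertible (rho M)"
  unfolding carrier_GL using rho_invertible_iff by auto

lemma to_mat_GL: "invertible A \<Longrightarrow> to_mat A \<in> carrier (GL CARD('n))"
  by (simp add: carrier_GL_iff to_mat_carrier rho_to_mat)

lemma regular_entry: "(\<lambda>M. rho M $ i $ j) \<in> regular_functions_GL CARD('n)"
  unfolding regular_functions_GL_def rho_def vec_lambda_beta
  by (rule generated_algebra.gen) (use idx_less in blast)

lemmas regular_functions_GL_const = generated_algebra.const[of _
    "{\<lambda>A. A $$ (i, j) | i j. i < m \<and> j < m} \<union> {\<lambda>A. inverse (Determinant.det A)}" for m,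
    folded regular_functions_GL_def]

lemmas regular_functions_GL_mult = generated_algebra.mult[of _
    "{\<lambda>A. A $$ (i, j) | i j. i < m \<and> j < m} \<union> {\<lambda>A. inverse (Determinant.det A)}" for m,
    folded regular_functions_GL_def]

lemmas regular_functions_GL_sum = generated_algebra_sum[of _ _
    "{\<lambda>A. A $$ (i, j) | i j. i < m \<and> j < m} \<union> {\<lambda>A. inverse (Determinant.det A)}" for m,
    folded regular_functions_GL_def]

lemmas regular_functions_GL_prod = generated_algebra_prod[of _ _
    "{\<lambda>A. A $$ (i, j) | i j. i < m \<and> j < m} \<union> {\<lambda>A. inverse (Determinant.det A)}" for m,
    folded regular_functions_GL_def]

lemma regular_polynomial:
  assumes "p \<in> polynomial_functions"
  shows "(\<lambda>M. p (rho M *v x)) \<in> regular_functions_GL CARD('n)"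
  unfolding regular_functions_GL_def
  by (rule polynomial_functions_compose[OF assms])
    (unfold regular_functions_GL_def[symmetric] matrix_vector_mult_def vec_lambda_beta,
      intro regular_functions_GL_sum regular_functions_GL_mult regular_functions_GL_const regular_entry)

text \<open>The entries of the inverse transpose are cofactors over the determinant, and the Leibniz
  formula displays each cofactor as a polynomial in the entries.\<close>

lemma regular_contra:
  "\<exists>p\<in>regular_functions_GL CARD('n). \<forall>M\<in>carrier (GL CARD('n)). contra (rho M) $ i $ j = p M"
proof
  \<comment> \<open>Deleting row or column b shifts the indices from b onwards by one.\<close>
  let ?s = "\<lambda>b a. if a < b then a else Suc a" and ?m = "CARD('n) - 1"
  let ?p = "\<lambda>M. inverse (Determinant.det M) * ((-1) ^ (idx i + idx j) *
    (\<Sum>p\<in>{p. p permutes {0..<?m}}. of_int (sign p) *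
      (\<Prod>a=0..<?m. M $$ (?s (idx i) a, ?s (idx j) (p a)))))"
  have det: "(\<lambda>M. inverse (Determinant.det M)) \<in> regular_functions_GL CARD('n)"
    unfolding regular_functions_GL_def by (rule generated_algebra.gen) blast
  have entry: "(\<lambda>M. M $$ (a, b)) \<in> regular_functions_GL CARD('n)"
    if "a < CARD('n)" "b < CARD('n)" for a b
    unfolding regular_functions_GL_def by (rule generated_algebra.gen) (use that in blast)
  show "?p \<in> regular_functions_GL CARD('n)"
  proof (intro regular_functions_GL_mult det regular_functions_GL_const regular_functions_GL_sum
      regular_functions_GL_prod entry)
    fix p a assume "p \<in> {p. p permutes {0..<?m}}" "a \<in> {0..<?m}"
    then have "a < ?m" "p a < ?m" using permutes_in_image[of p "{0..<?m}" a] by simp_all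
    then show "?s (idx i) a < CARD('n)" "?s (idx j) (p a) < CARD('n)" by auto
  qed
  show "\<forall>M\<in>carrier (GL CARD('n)). contra (rho M) $ i $ j = ?p M"
  proof
    fix M assume "M \<in> carrier (GL CARD('n))"
    then have M: "M \<in> carrier_mat CARD('n) CARD('n)" "Determinant.det M \<noteq> 0"
      by (auto simp: carrier_GL)
    have "Determinant.det (mat_delete M (idx i) (idx j)) =
      (\<Sum>p\<in>{p. p permutes {0..<?m}}. of_int (sign p) *
        (\<Prod>a=0..<?m. mat_delete M (idx i) (idx j) $$ (a, p a)))"
      by (rule det_def'[OF mat_delete_carrier[OF M(1)]])
    also have "\<dots> = (\<Sum>p\<in>{p. p permutes {0..<?m}}. of_int (sign p) *
      (\<Prod>a=0..<?m. M $$ (?s (idx i) a, ?s (idx j) (p a))))"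
    proof (intro sum.cong refl arg_cong2[where f = "(*)"] prod.cong)
      fix p a assume "p \<in> {p. p permutes {0..<?m}}" "a \<in> {0..<?m}"
      then have "a < ?m" "p a < ?m" using permutes_in_image[of p "{0..<?m}" a] by simp_all
      then show "mat_delete M (idx i) (idx j) $$ (a, p a) = M $$ (?s (idx i) a, ?s (idx j) (p a))"
        using M(1) by (auto simp: mat_delete_def)
    qed
    finally show "contra (rho M) $ i $ j = ?p M"
      by (simp add: contra_rho[OF M] cofactor_def)
  qed
qed

end

lemma mult_GL [simp]: "mult (GL m) = (*)"
  by (simp add: GL_def units_of_def ring_mat_simps)

lemma one_GL [simp]: "one (GL m) = 1\<^sub>m m"
  by (simp add: GL_def units_of_def ring_mat_simps)

lemma group_GL: "group (GL m)"
proof -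
  interpret ring "ring_mat TYPE(complex) m ()" by (rule ring_mat)
  show ?thesis unfolding GL_def by (rule units_group)
qed

locale similitude_group = based_adjoint_pair F H c + enumeration idx
  for F H :: "complex ^ 'n \<Rightarrow> complex ^ 'n \<Rightarrow> complex ^ 'n \<Rightarrow> complex" and c and idx :: "'n \<Rightarrow> nat"
begin

definition G :: "complex mat set" where
  "G = {M \<in> carrier (GL CARD('n)). \<exists>k. similitude F (rho M) k}"

definition sigma :: "complex mat \<Rightarrow> complex mat" where
  "sigma M = to_mat (theta (rho M))"

lemma G_D:
  assumes "M \<in> G"
  shows "M \<in> carrier (GL CARD('n))" "M \<in> carrier_mat CARD('n) CARD('n)" "invertible (rho M)"
    "\<exists>k. similitude F (rho M) k"
  using assms by (auto simp: G_def carrier_GL_iff)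

lemma similitude_inv: "similitude F A k \<Longrightarrow> invertible A"
  by (rule similitude_invertible[of _ _ c]) (simp_all add: nrm_base)

lemma to_mat_G: "similitude F A k \<Longrightarrow> to_mat A \<in> G"
  using similitude_inv by (auto simp: G_def to_mat_GL rho_to_mat)

lemma nrm_polynomial: "nrm F \<in> polynomial_functions"
  using A.polynomial_functions_nrm[of "\<lambda>x. x"] polynomial_functions_coord by blast

lemma G_multiplier:
  assumes "M \<in> G"
  shows "nrm F (rho M *v c) \<noteq> 0" "nrm F (rho M *v x) = nrm F (rho M *v c) * nrm F x"
proof -
  obtain k where "similitude F (rho M) k" using G_D(4)[OF assms] ..
  then show "nrm F (rho M *v c) \<noteq> 0" "nrm F (rho M *v x) = nrm F (rho M *v c) * nrm F x"
    by (auto simp: similitude_def nrm_base)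
qed

lemma subgroup_G: "subgroup G (GL CARD('n))"
proof -
  interpret GL: group "GL CARD('n)" by (rule group_GL)
  show ?thesis
  proof
    show "G \<subseteq> carrier (GL CARD('n))" by (auto simp: G_def)
    show "\<one>\<^bsub>GL CARD('n)\<^esub> \<in> G"
      using GL.one_closed by (auto simp: G_def rho_one similitude_def intro!: exI[of _ 1])
  next
    fix M N assume MN: "M \<in> G" "N \<in> G"
    obtain k l where "similitude F (rho M) k" "similitude F (rho N) l"
      using G_D(4) MN by meson
    then have "similitude F (rho (M * N)) (k * l)"
      using MN by (simp add: rho_mult G_D similitude_mult)
    then show "M \<otimes>\<^bsub>GL CARD('n)\<^esub> N \<in> G"
      using GL.m_closed[OF MN[THEN G_D(1)]] by (auto simp: G_def)
  next
    fix M assume M: "M \<in> G"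
    let ?N = "inv\<^bsub>GL CARD('n)\<^esub> M"
    have N: "?N \<in> carrier (GL CARD('n))" using G_D(1)[OF M] by simp
    have "M * ?N = 1\<^sub>m CARD('n)" using GL.r_inv[OF G_D(1)[OF M]] by simp
    then have "rho M ** rho ?N = Finite_Cartesian_Product.mat 1"
      using rho_mult[OF G_D(2)[OF M], of ?N] N by (simp add: carrier_GL_iff rho_one)
    moreover obtain k where "similitude F (rho M) k" using G_D(4)[OF M] ..
    ultimately have "similitude F (rho ?N) (1 / k)" by (intro similitude_inverse)
    then show "?N \<in> G" using N by (auto simp: G_def)
  qed
qed

text \<open>Because N(c) = 1, the multiplier of M is N(M c). This eliminates the unknown k, and G is
  cut out by the equations N(M x) = N(M c) N(x), one for each x.\<close>

lemma linear_algebraic_group_G: "linear_algebraic_group CARD('n) G"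
proof -
  let ?p = "\<lambda>x M. nrm F (rho M *v x) - nrm F (rho M *v c) * nrm F x"
  have reg: "(\<lambda>M. nrm F (rho M *v x)) \<in> regular_functions_GL CARD('n)" for x
    by (rule regular_polynomial[OF nrm_polynomial])
  have "?p x \<in> regular_functions_GL CARD('n)" for x
    using generated_algebra_diff[OF reg[of x, unfolded regular_functions_GL_def]
        generated_algebra.mult[OF reg[of c, unfolded regular_functions_GL_def]
          generated_algebra.const[of "nrm F x"]]]
    unfolding regular_functions_GL_def .
  then have "range ?p \<subseteq> regular_functions_GL CARD('n)" by (rule image_subsetI)
  moreover have "G = {M \<in> carrier (GL CARD('n)). \<forall>p\<in>range ?p. p M = 0}"
  proof (intro equalityI subsetI)
    fix M assume M: "M \<in> G"
    have "?p x M = 0" for x by (simp only: G_multiplier(2)[OF M, of x] diff_self)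
    then show "M \<in> {M \<in> carrier (GL CARD('n)). \<forall>p\<in>range ?p. p M = 0}"
      using G_D(1)[OF M] by blast
  next
    fix M assume M: "M \<in> {M \<in> carrier (GL CARD('n)). \<forall>p\<in>range ?p. p M = 0}"
    then have MG: "M \<in> carrier (GL CARD('n))" and 0: "\<forall>p\<in>range ?p. p M = 0"
      unfolding mem_Collect_eq by (elim conjunct1, elim conjunct2)
    have "?p x M = 0" for x by (rule bspec[OF 0 rangeI])
    then have N: "nrm F (rho M *v x) = nrm F (rho M *v c) * nrm F x" for x
      by (rule eq_iff_diff_eq_0[THEN iffD2])
    \<comment> \<open>The equation at x = M^{-1} c shows that the multiplier is nonzero.\<close>
    obtain B where "rho M ** B = Finite_Cartesian_Product.mat 1"
      using MG by (auto simp: carrier_GL_iff invertible_def)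
    then have "rho M *v (B *v c) = c" by (simp add: matrix_vector_mul_assoc)
    then have "nrm F (rho M *v c) * nrm F (B *v c) = 1" using N[of "B *v c"] nrm_base by simp
    then have "similitude F (rho M) (nrm F (rho M *v c))"
      unfolding similitude_def by (intro conjI allI N) auto
    then show "M \<in> G" using MG unfolding G_def by blast
  qed
  ultimately show ?thesis
    unfolding linear_algebraic_group_def zariski_GL_def regular_functions_GL_def closedin_zariski_iff
    by (intro conjI subgroup_G exI[of _ "range ?p"])
qed

lemma rational_representation_rho: "rational_representation CARD('n) G rho"
  unfolding rational_representation_def regular_on_def
proof (intro conjI ballI allI rho_one)
  show "rho (M * N) = rho M ** rho N" if "M \<in> G" "N \<in> G" for M N
    using that by (intro rho_mult G_D(2))
  show "\<exists>p\<in>regular_functions_GL CARD('n). \<forall>M\<in>G. rho M $ i $ j = p M" for i j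
    by (rule bexI[OF _ regular_entry[of i j]]) simp
qed

lemma relative_invariant_nrm: "relative_invariant CARD('n) G rho (nrm F)"
  unfolding relative_invariant_def
proof (intro conjI exI[of _ "\<lambda>M. nrm F (rho M *v c)"] ballI allI nrm_polynomial)
  show "nrm F \<noteq> (\<lambda>_. 0)" using nrm_base by (metis zero_neq_one)
  show "rational_character CARD('n) G (\<lambda>M. nrm F (rho M *v c))"
    unfolding rational_character_def regular_on_def
  proof (intro conjI ballI bexI)
    show "nrm F (rho (1\<^sub>m CARD('n)) *v c) = 1" by (simp add: rho_one nrm_base)
    show "nrm F (rho (M * N) *v c) = nrm F (rho M *v c) * nrm F (rho N *v c)"
      if "M \<in> G" "N \<in> G" for M N
      unfolding rho_mult[OF that[THEN G_D(2)]] matrix_vector_mul_assoc[symmetric]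
      by (rule G_multiplier(2)[OF that(1)])
  qed (rule refl, rule regular_polynomial[OF nrm_polynomial])
qed (rule G_multiplier)

lemma rep_orbit_base: "rep_orbit G rho c = {x. nrm F x \<noteq> 0}"
proof (intro equalityI subsetI)
  fix x assume "x \<in> rep_orbit G rho c"
  then show "x \<in> {x. nrm F x \<noteq> 0}" using G_multiplier(1) by (auto simp: rep_orbit_def)
next
  fix x assume "x \<in> {x. nrm F x \<noteq> 0}"
  then obtain A k where "similitude F A k" "A *v c = x"
    using similitude_transitive[of c x] nrm_base by auto
  then show "x \<in> rep_orbit G rho c"
    unfolding rep_orbit_def using to_mat_G rho_to_mat by (metis (mono_tags, lifting) mem_Collect_eq)
qed

lemma dense_orbit: "has_dense_open_orbit G rho c"
  unfolding has_dense_open_orbit_def rep_orbit_base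
proof
  show "openin zariski_V {x. nrm F x \<noteq> 0}"
    unfolding zariski_V_def zariski_def
    by (rule topology_generated_by_Basis) (use nrm_polynomial in auto)
  let ?C = "Abstract_Topology.closure_of zariski_V {x. nrm F x \<noteq> 0}"
  have "closedin zariski_V ?C" by (rule closedin_closure_of)
  then obtain P where P: "P \<subseteq> polynomial_functions" "?C = {x. \<forall>p\<in>P. p x = 0}"
    unfolding zariski_V_def polynomial_functions_def closedin_zariski_iff by auto
  have "{x. nrm F x \<noteq> 0} \<subseteq> ?C"
    by (rule closure_of_subset)
      (simp add: zariski_V_def polynomial_functions_def topspace_zariski)
  \<comment> \<open>An equation of the closure holds wherever N is nonzero, so its product with N
    vanishes everywhere.\<close>
  then have "p x * nrm F x = 0" if "p \<in> P" for p x
    using that unfolding P(2) by auto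
  then have "p x = 0" if "p \<in> P" for p x
    using that P(1) nrm_base
    by (intro polynomial_function_mult_zero[OF _ nrm_polynomial, of p c]) (auto simp: mult.commute)
  then show "?C = UNIV" unfolding P(2) by auto
qed

lemma sigma_G:
  assumes "M \<in> G"
  shows "sigma M \<in> G" "rho (sigma M) = theta (rho M)"
  using G_D(4)[OF assms] similitude_theta to_mat_G by (auto simp: sigma_def rho_to_mat)

lemma group_involution_sigma: "group_involution CARD('n) G sigma"
  unfolding group_involution_def
proof (intro conjI allI impI ballI)
  show "sigma \<in> hom (GL CARD('n)\<lparr>carrier := G\<rparr>) (GL CARD('n)\<lparr>carrier := G\<rparr>)"
  proof (rule homI)
    fix M N assume "M \<in> carrier (GL CARD('n)\<lparr>carrier := G\<rparr>)" "N \<in> carrier (GL CARD('n)\<lparr>carrier := G\<rparr>)"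
    then have MN: "M \<in> G" "N \<in> G" by auto
    then have "M * N \<in> G" using subgroup.m_closed[OF subgroup_G] by simp
    have "sigma (M * N) = sigma M * sigma N"
    proof (rule rho_inj)
      show "sigma M * sigma N \<in> carrier_mat CARD('n) CARD('n)"
        using MN by (intro mult_carrier_mat[of _ _ "CARD('n)"] G_D(2) sigma_G)
      show "rho (sigma (M * N)) = rho (sigma M * sigma N)"
        using MN \<open>M * N \<in> G\<close> by (simp add: sigma_G rho_mult G_D theta_mult)
    qed (use \<open>M * N \<in> G\<close> in \<open>simp add: G_D(2) sigma_G(1)\<close>)
    then show "sigma (M \<otimes>\<^bsub>GL CARD('n)\<lparr>carrier := G\<rparr>\<^esub> N) =
      sigma M \<otimes>\<^bsub>GL CARD('n)\<lparr>carrier := G\<rparr>\<^esub> sigma N" by simp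
  qed (simp add: sigma_G)
next
  fix a b assume ab: "a < CARD('n)" "b < CARD('n)"
  let ?i = "inv_into UNIV idx a" and ?j = "inv_into UNIV idx b"
  obtain p where p: "\<And>i j. p i j \<in> regular_functions_GL CARD('n)"
    "\<And>i j M. M \<in> carrier (GL CARD('n)) \<Longrightarrow> contra (rho M) $ i $ j = p i j M"
    using regular_contra by metis
  let ?q = "\<lambda>M. \<Sum>k\<in>UNIV. (\<Sum>l\<in>UNIV. uc $ ?i $ l * p l k M) * uc' $ k $ ?j"
  have "?q \<in> regular_functions_GL CARD('n)"
    by (intro regular_functions_GL_sum regular_functions_GL_mult regular_functions_GL_const p(1))
  moreover have "sigma M $$ (a, b) = ?q M" if "M \<in> G" for M
    using ab p(2)[OF G_D(1)[OF that]]
    by (simp add: sigma_def to_mat_def theta_def matrix_matrix_mult_def)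
  ultimately show "regular_on CARD('n) G (\<lambda>M. sigma M $$ (a, b))"
    unfolding regular_on_def by (intro bexI[of _ ?q] ballI)
next
  fix M assume M: "M \<in> G"
  show "sigma (sigma M) = M"
    by (rule rho_inj) (use M in \<open>simp_all add: G_D sigma_G theta_theta\<close>)
next
  \<comment> \<open>The scalar 2 is moved by the involution: otherwise U_{2c} = U_c, that is 4 c = c
    at c#.\<close>
  let ?A = "Finite_Cartesian_Product.mat 2 :: complex ^ 'n ^ 'n"
  have A: "?A *v x = 2 *s x" for x
    by (simp add: Finite_Cartesian_Product.vec_eq_iff matrix_vector_mult_def
        Finite_Cartesian_Product.mat_def if_distrib[of "\<lambda>y. y * _"] cong: if_cong)
  have sim: "similitude F ?A 8"
    by (simp add: similitude_def A A.nrm_scale)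
  have "sigma (to_mat ?A) \<noteq> to_mat ?A"
  proof
    assume "sigma (to_mat ?A) = to_mat ?A"
    then have "theta ?A = ?A" using sigma_G(2)[OF to_mat_G[OF sim]] by (simp add: rho_to_mat)
    then have "uop F H (2 *s c) (shp F c) = uop F H c (shp F c)"
      using theta_fixed_iff[OF sim] by (simp add: A)
    then have "2\<^sup>2 *s c = 1 *s c"
      by (simp only: uop_scale_base uop_shp_self nrm_base vector_smult_lid)
    then have "c = 0" by (simp only: vector_mul_rcancel) simp
    then show False using nrm_base by simp
  qed
  then show "\<exists>M\<in>G. sigma M \<noteq> M" using to_mat_G[OF sim] by (intro bexI[of _ "to_mat ?A"])
qed

lemma fixed_points_iff:
  assumes "M \<in> G"
  shows "M \<in> fixed_points G sigma \<longleftrightarrow> (\<forall>y. uop F H (rho M *v c) y = uop F H c y)"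
proof -
  obtain k where k: "similitude F (rho M) k" using G_D(4)[OF assms] ..
  have "sigma M = M \<longleftrightarrow> theta (rho M) = rho M"
    using rho_inj[OF G_D(2)[OF sigma_G(1)[OF assms]] G_D(2)[OF assms]] sigma_G(2)[OF assms] by auto
  then show ?thesis using assms theta_fixed_iff[OF k] by (simp add: fixed_points_def)
qed

lemma stabilizer_fixed: "rep_stabilizer G rho c \<subseteq> fixed_points G sigma"
  using fixed_points_iff by (auto simp: rep_stabilizer_def)

lemma identity_component_stabilizes:
  "identity_component CARD('n) (fixed_points G sigma) \<subseteq> rep_stabilizer G rho c"
proof
  let ?K = "fixed_points G sigma" and ?R = "regular_functions_GL CARD('n)"
  let ?X = "subtopology (zariski_GL CARD('n)) ?K"
  define phi where "phi = (\<lambda>M. pr (rho M *v c) (shp F c))"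
  have phi: "phi \<in> ?R"
    unfolding phi_def
    by (rule regular_polynomial[of "\<lambda>x. pr x (shp F c)"])
      (unfold pr_def, intro polynomial_functions_sum polynomial_functions_mult
        polynomial_functions_coord polynomial_functions_const)
  have K: "?K \<subseteq> carrier (GL CARD('n))" using G_D(1) by (auto simp: fixed_points_def)
  have cl: "closedin ?X {M \<in> ?K. p M = 0}" if "p \<in> ?R" for p
  proof -
    have "closedin (zariski_GL CARD('n)) {M \<in> carrier (GL CARD('n)). \<forall>q\<in>{p}. q M = 0}"
      using that unfolding zariski_GL_def regular_functions_GL_def closedin_zariski_iff by blast
    moreover have "{M \<in> ?K. p M = 0} = ?K \<inter> {M \<in> carrier (GL CARD('n)). \<forall>q\<in>{p}. q M = 0}"
      using K by auto
    ultimately show ?thesis by (simp only: closedin_subtopology_Int_closed)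
  qed
  have top: "topspace ?X = ?K"
    using K by (auto simp: zariski_GL_def regular_functions_GL_def topspace_zariski)
  have fixed: "phi M = 3 \<Longrightarrow> rho M *v c = c" "phi M = 3 \<or> (phi M + 3) * ((phi M)\<^sup>2 - 1) = 0"
    if "M \<in> ?K" for M
    using that fixed_points_iff uop_eq_isolated[OF nrm_base, of "rho M *v c"]
    by (auto simp: phi_def fixed_points_def)
  \<comment> \<open>Both parts are zero sets of regular functions and they are complementary, so the
    part of trace 3, which contains the identity, is clopen.\<close>
  let ?A = "{M \<in> ?K. phi M - 3 = 0}" and ?B = "{M \<in> ?K. (phi M + 3) * ((phi M)\<^sup>2 - 1) = 0}"
  have "(\<lambda>M. phi M - 3) \<in> ?R" "(\<lambda>M. (phi M + 3) * ((phi M)\<^sup>2 - 1)) \<in> ?R"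
    using phi unfolding regular_functions_GL_def power2_eq_square
    by (intro generated_algebra_diff generated_algebra.mult generated_algebra.add
        generated_algebra.const; assumption)+
  from this[THEN cl] have A: "closedin ?X ?A" and B: "closedin ?X ?B" by simp_all
  have eq: "?A = topspace ?X - ?B" unfolding top using fixed(2) by auto
  have "openin ?X ?A" unfolding eq using B by (simp only: closedin_def)
  fix M assume "M \<in> identity_component CARD('n) ?K"
  then obtain C where C: "connectedin ?X C" "1\<^sub>m CARD('n) \<in> C" "M \<in> C"
    by (auto simp: identity_component_def connected_component_of_def)
  have "1\<^sub>m CARD('n) \<in> ?K" using C(1,2) connectedin_subset_topspace top by blast
  then have "1\<^sub>m CARD('n) \<in> ?A" by (simp add: phi_def rho_one A.pr_shp nrm_base)
  then have "C \<subseteq> ?A"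
    using connectedin_clopen_cases[OF C(1) A \<open>openin ?X ?A\<close>] C(2) by (auto simp: disjnt_iff)
  then have "M \<in> ?K" "phi M = 3" using C(3) by auto
  then show "M \<in> rep_stabilizer G rho c"
    using fixed(1) by (auto simp: rep_stabilizer_def fixed_points_def)
qed

lemma prehomogeneous_symmetric: "prehomogeneous_symmetric_space CARD('n) G rho"
  unfolding prehomogeneous_symmetric_space_def prehomogeneous_vector_space_def
  using linear_algebraic_group_G rational_representation_rho dense_orbit group_involution_sigma
    stabilizer_fixed identity_component_stabilizes by blast

lemma irreducible_or_factor:
  "irreducible_representation G rho \<or>
    (\<exists>p q. p \<in> polynomial_functions \<and> q \<in> polynomial_functions \<and> p 0 = 0 \<and> q 0 = 0 \<and>
      nrm F = (\<lambda>x. p x * q x))"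
proof (cases "irreducible_representation G rho")
  case False
  then obtain W where W: "vec.subspace W" "W \<noteq> {0}" "W \<noteq> UNIV"
    and inv: "\<And>M w. M \<in> G \<Longrightarrow> w \<in> W \<Longrightarrow> rho M *v w \<in> W"
    unfolding irreducible_representation_def by blast
  have "\<exists>p q. p \<in> polynomial_functions \<and> q \<in> polynomial_functions \<and> p 0 = 0 \<and> q 0 = 0 \<and>
    nrm F = (\<lambda>x. p x * q x)"
  proof (rule invariant_subspace_factor[OF W])
    show "A *v w \<in> W" if "similitude F A k" "w \<in> W" for A k w
      using inv[OF to_mat_G[OF that(1)] that(2)] by (simp add: rho_to_mat)
  qed
  then show ?thesis ..
qed simp

end

text \<open>As p 0 = 0, p is not a unit, so irreducibility makes f divide p, say p = f r. Then p (1
  - q r) = 0, and the second factor is 1 at the origin, which forces p = 0.\<close>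

lemma ring_irreducible_not_factor:
  assumes "ring_irreducible\<^bsub>polynomial_function_ring\<^esub> f"
    and p: "p \<in> polynomial_functions" "p 0 = 0" and q: "q \<in> polynomial_functions" "q 0 = 0"
    and f: "f = (\<lambda>x. p x * q x)"
  shows False
proof -
  let ?R = "polynomial_function_ring :: (complex ^ 'a \<Rightarrow> complex) ring"
  have irr: "f \<noteq> (\<lambda>_. 0)" "properfactor ?R p f \<Longrightarrow> p \<in> Units ?R"
    using assms(1) p(1) unfolding ring_irreducible_def Divisibility.irreducible_def
    by (simp_all add: polynomial_function_ring_def)
  have "p \<notin> Units ?R"
    using p(2) by (auto simp: Units_def polynomial_function_ring_def fun_eq_iff)
      (metis mult_zero_right mult_zero_left zero_neq_one)
  then have "\<not> properfactor ?R p f" using irr(2) by blast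
  moreover have "p divides\<^bsub>?R\<^esub> f"
    using q(1) f by (auto simp: factor_def polynomial_function_ring_def)
  ultimately have "f divides\<^bsub>?R\<^esub> p" by (auto simp: properfactor_def)
  then obtain r where r: "r \<in> polynomial_functions" "p = (\<lambda>x. f x * r x)"
    by (auto simp: factor_def polynomial_function_ring_def)
  have "p x * (1 - q x * r x) = 0" for x
    using fun_cong[OF r(2), of x] by (simp add: f algebra_simps)
  moreover have "(\<lambda>x. 1 - q x * r x) \<in> polynomial_functions"
    using q(1) r(1) by (intro polynomial_functions_diff polynomial_functions_mult polynomial_functions_const)
  moreover have "1 - q 0 * r 0 \<noteq> 0" using q(2) by simp
  ultimately have "p x = 0" for x
    using polynomial_function_mult_zero[OF p(1), of "\<lambda>x. 1 - q x * r x" 0 x] by (simp add: mult.commute)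
  then show False using irr(1) f by simp
qed

lemma adjoint_pair_base_point:
  assumes "adjoint_pair F H" "nrm F \<noteq> (\<lambda>_. 0)"
  obtains c where "nrm F c = 1"
proof -
  interpret adjoint_pair F H by fact
  obtain x where x: "nrm F x \<noteq> 0" using assms(2) by (auto simp: fun_eq_iff)
  \<comment> \<open>A cube root of 1 / N(x), since N has degree three.\<close>
  let ?s = "exp (Ln (1 / nrm F x) / 3)"
  have "?s ^ 3 = 1 / nrm F x" using x by (simp add: exp_of_nat_mult[symmetric])
  then have "nrm F (?s *s x) = 1" using x by (simp add: A.nrm_scale)
  then show ?thesis by (rule that)
qed

theorem theorem2:
  fixes f :: "complex ^ 'n \<Rightarrow> complex"
  assumes "CARD('n) \<ge> 2"
    and "ring_irreducible\<^bsub>polynomial_function_ring\<^esub> f"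
    and "EKP_homaloidal f"
    and "homogeneous_function 3 f"
  shows "\<exists>m G (\<rho> :: complex mat \<Rightarrow> complex ^ 'n ^ 'n).
    prehomogeneous_symmetric_space m G \<rho> \<and> irreducible_representation G \<rho> \<and>
    relative_invariant m G \<rho> f"
proof -
  obtain F H where FH: "adjoint_pair F H" and f: "f = nrm F"
    using EKP_homaloidal_cubic_adjoint_pair[OF assms(3,4)] .
  have "f \<noteq> (\<lambda>_. 0)"
    using assms(2) by (simp add: ring_irreducible_def polynomial_function_ring_def)
  then obtain c where c: "nrm F c = 1" using adjoint_pair_base_point[OF FH] f by metis
  obtain idx :: "'n \<Rightarrow> nat" where idx: "bij_betw idx UNIV {0..<CARD('n)}"
    using ex_bij_betw_finite_nat[of "UNIV :: 'n set"] by auto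
  interpret adjoint_pair F H by (rule FH)
  interpret similitude_group F H c idx by unfold_locales (use c idx in auto)
  have "irreducible_representation G rho"
    using irreducible_or_factor ring_irreducible_not_factor[OF assms(2)] unfolding f by blast
  then show ?thesis using prehomogeneous_symmetric relative_invariant_nrm unfolding f by blast
qed

end
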